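(* Let $D\subset\overline{\mathbb R}^d$ be a closed cone, $\alpha>0$, and let $X$ be a random vector in $\mathbb R^d$ with $X\in RV_\alpha(\{a_n\},D,\nu)$, where $\nu(\overline{\mathbb R}^d\setminus(\mathbb R^d\cup D))=0$. Let $(\tau,\theta)$ be polar coordinates in $\mathbb R^d\setminus D$ with unit sphere $S$ and let $\sigma$ be the corresponding spectral measure of $\nu$. Let $f:\overline{\mathbb R}^d\to[0,\infty]$ be Borel measurable such that: (H) $f(x)<\infty$ for $x\in\mathbb R^d$, $f(0)=0$, and $f(\lambda x)=\lambda f(x)$ for all $\lambda>0$ and $x\ne 0$; (F) for every $\epsilon>0$ the set $\{f>\epsilon\}$ is bounded away from $D$, and $\inf_{x\in K}f(x)>0$ for every compact $K\subset\overline{\mathbb R}^d\setminus D$; (C) $\nu(\overline{\mathrm{Disc}(f)})=0$, where $\overline{\mathrm{Disc}(f)}$ is the closure in $\overline{\mathbb R}^d\setminus D$ of the set of discontinuity points of $f$. Let $X_1,X_2,\dots$ be independent copies of $X$ and let $k(n)$ be the smallest index $k\in\{1,\dots,n\}$ with $f(X_k)=\max_{1\le i\le n}f(X_i)$. Then $$a_n^{-1}X_{k(n)}\Longrightarrow Y\quad\text{as }n\to\infty$$ (convergence in distribution), where $Y$ is a random vector taking values in $\overline{\mathbb R}^d\setminus D$ with distribution $$P_Y(dx)=e^{-Cf(x)^{-\alpha}}\,\nu(dx),\qquad C:=\nu(\{z: f(z)>1\})=\int_S f(\theta)^\alpha\,\sigma(d\theta)<\infty.$$ Moreover $Y$ is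 proper, i.e. it takes values in $\mathbb R^d\setminus D$.
   Context: $\overline{\mathbb R}=[-\infty,\infty]$ carries its usual compact topology and $\overline{\mathbb R}^d$ the product topology. A set $D\subset\overline{\mathbb R}^d$ is a (positive) cone if $\lambda D\subset D$ for all $\lambda>0$. For a closed cone $D$, put $\overline{\mathbb R}^d_D:=\overline{\mathbb R}^d\setminus D$ (relative topology) and $\mathbb R^d_D:=\mathbb R^d\setminus D$. A set $F\subset\overline{\mathbb R}^d_D$ is bounded away from $D$ if $F\subset\overline{\mathbb R}^d\setminus U$ for some open $U\supset D$ in $\overline{\mathbb R}^d$; the compact subsets of $\overline{\mathbb R}^d_D$ are exactly its relatively closed subsets bounded away from $D$. Radon measures on $\overline{\mathbb R}^d_D$ are Borel measures finite on compacts; $\nu_n\stackrel{v}{\to}\nu$ (vague convergence) means $\int h\,d\nu_n\to\int h\,d\nu$ for every continuous compactly supported $h:\overline{\mathbb R}^d_D\to\mathbb R$. Regular variation: a random vector $X$ in $\mathbb R^d$ satisfies $X\in RV_\alpha(\{a_n\},D,\nu)$, $\alpha>0$, if $\nu$ is a non-trivial Radon measure on $\overline{\mathbb R}^d_D$ supported on $\mathbb R^d_D$, $a_n>0$ is a regularly varying sequence with exponent $1/\alpha$, and $nP(a_n^{-1}X\in\cdot)\stackrel{v}{\to}\nu$ on $\overline{\mathbb R}^d_D$ as $n\to\infty$. Then $\nu(\lambda\,\cdot)=\lambda^{-\alpha}\nu(\cdot)$ for all $\lambda>0$. Polar coordinates: let $\tau:\overline{\mathbb R}^d\to[0,\infty]$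 be continuous with $\{\tau=0\}=D$, $\tau(x)<\infty$ for $x\in\mathbb R^d$, and $\tau(\lambda x)=\lambda\tau(x)$ for all $\lambda>0$, $x\in\overline{\mathbb R}^d$. The polar coordinates of $x\in\mathbb R^d\setminus D$ are $(\tau(x),\theta(x))$ with $\theta(x)=x/\tau(x)$; the unit sphere is $S=\{\tau=1\}\cap\mathbb R^d$. The spectral measure of $\nu$ is the finite measure $\sigma=\sigma_S$ on $S$ given by $\sigma_S(B)=\nu\{x:\tau(x)>1,\ \theta(x)\in B\}$; it satisfies $\nu(A)=\int_S\int_0^\infty 1_A(\tau\theta)\,\alpha\tau^{-\alpha-1}\,d\tau\,\sigma_S(d\theta)$ for measurable $A\subset\mathbb R^d_D$. *)

theory Defs
  imports "HOL-Probability.Probability"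
begin

text \<open>The space $[-\infty,\infty]^d$ is the type \<^typ>\<open>ereal ^ 'n\<close>, whose library topology
  is the product topology.\<close>

definition evec :: "real ^ 'n \<Rightarrow> ereal ^ 'n" where
  "evec x = (\<chi> i. ereal (x $ i))"

definition escale :: "real \<Rightarrow> ereal ^ 'n \<Rightarrow> ereal ^ 'n" where
  "escale c x = (\<chi> i. ereal c * x $ i)"

definition pos_cone :: "(ereal ^ 'n) set \<Rightarrow> bool" where
  "pos_cone D \<longleftrightarrow> (\<forall>c>0. escale c ` D \<subseteq> D)"

definition bounded_away :: "'a::topological_space set \<Rightarrow> 'a set \<Rightarrow> bool" where
  "bounded_away D F \<longleftrightarrow> (\<exists>U. open U \<and> D \<subseteq> U \<and> F \<subseteq> - U)"

definition radon_measure_on :: "'a::topological_space set \<Rightarrow> 'a measure \<Rightarrow> bool" where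
  "radon_measure_on E N \<longleftrightarrow>
     sets N = sets (restrict_space borel E) \<and>
     (\<forall>K. compact K \<and> K \<subseteq> E \<longrightarrow> emeasure N K < \<infinity>)"

text \<open>For measures on the open subspace \<open>E\<close>; values of the test function outside \<open>E\<close> play
  no role.\<close>

definition vague_conv_on ::
    "'a::topological_space set \<Rightarrow> (nat \<Rightarrow> 'a measure) \<Rightarrow> 'a measure \<Rightarrow> bool" where
  "vague_conv_on E N_seq N \<longleftrightarrow>
     (\<forall>h::'a \<Rightarrow> real.
        continuous_on E h \<and> (\<exists>K. compact K \<and> K \<subseteq> E \<and> (\<forall>x\<in>E - K. h x = 0)) \<longrightarrow>
        (\<lambda>n. \<integral>x. h x \<partial>N_seq n) \<longlonglongrightarrow> (\<integral>x. h x \<partial>N))"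

definition reg_varying_seq :: "(nat \<Rightarrow> real) \<Rightarrow> real \<Rightarrow> bool" where
  "reg_varying_seq a \<rho> \<longleftrightarrow>
     (\<forall>t>0. (\<lambda>n. a (nat \<lfloor>t * real n\<rfloor>) / a n) \<longlonglongrightarrow> t powr \<rho>)"

text \<open>\<open>RV P X \<alpha> a D \<nu>\<close>: the random vector \<open>X\<close> on the probability space \<open>P\<close> satisfies
  $X \in RV_\alpha(\{a_n\}, D, \nu)$. The sequence starts at index 1.\<close>

definition RV ::
    "'a measure \<Rightarrow> ('a \<Rightarrow> real ^ 'n) \<Rightarrow> real \<Rightarrow> (nat \<Rightarrow> real) \<Rightarrow> (ereal ^ 'n) set
      \<Rightarrow> (ereal ^ 'n) measure \<Rightarrow> bool" where
  "RV P X \<alpha> a D \<nu> \<longleftrightarrow>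
     X \<in> borel_measurable P \<and> \<alpha> > 0 \<and>
     radon_measure_on (- D) \<nu> \<and>
     emeasure \<nu> (space \<nu>) \<noteq> 0 \<and>
     emeasure \<nu> (- D - range evec) = 0 \<and>
     (\<forall>n\<ge>1. a n > 0) \<and>
     reg_varying_seq a (1 / \<alpha>) \<and>
     vague_conv_on (- D)
       (\<lambda>n. scale_measure (of_nat n)
          (restrict_space (distr P borel (\<lambda>\<omega>. evec ((1 / a n) *\<^sub>R X \<omega>))) (- D)))
       \<nu>"

definition polar_radius :: "(ereal ^ 'n) set \<Rightarrow> (ereal ^ 'n \<Rightarrow> ennreal) \<Rightarrow> bool" where
  "polar_radius D \<tau> \<longleftrightarrow>
     continuous_on UNIV \<tau> \<and>
     {x. \<tau> x = 0} = D \<and>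
     (\<forall>x. \<tau> (evec x) < \<infinity>) \<and>
     (\<forall>c>0. \<forall>x. \<tau> (escale c x) = ennreal c * \<tau> x)"

definition polar_angle :: "(ereal ^ 'n \<Rightarrow> ennreal) \<Rightarrow> ereal ^ 'n \<Rightarrow> ereal ^ 'n" where
  "polar_angle \<tau> x = escale (1 / enn2real (\<tau> x)) x"

definition polar_sphere :: "(ereal ^ 'n \<Rightarrow> ennreal) \<Rightarrow> (ereal ^ 'n) set" where
  "polar_sphere \<tau> = {x. \<tau> x = 1} \<inter> range evec"

definition spectral_measure ::
    "(ereal ^ 'n) set \<Rightarrow> (ereal ^ 'n \<Rightarrow> ennreal) \<Rightarrow> (ereal ^ 'n) measure
      \<Rightarrow> (ereal ^ 'n) measure" where
  "spectral_measure D \<tau> \<nu> =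
     distr (restrict_space \<nu> {x \<in> range evec - D. \<tau> x > 1})
       (restrict_space borel (polar_sphere \<tau>)) (polar_angle \<tau>)"

text \<open>\<^const>\<open>isCont\<close> requires \<^class>\<open>t2_space\<close>, of which \<^typ>\<open>ereal ^ 'n\<close> is not declared an
  instance; the condition below is its characterization \<open>isCont_def\<close>.\<close>

definition Disc :: "('a::topological_space \<Rightarrow> 'b::topological_space) \<Rightarrow> 'a set" where
  "Disc f = {x. \<not> (f \<longlongrightarrow> f x) (at x)}"

definition first_argmax :: "(nat \<Rightarrow> 'b::linorder) \<Rightarrow> nat \<Rightarrow> nat" where
  "first_argmax g n = (LEAST k. k \<in> {1..n} \<and> g k = Max (g ` {1..n}))"

definition conv_in_distr ::
    "'a measure \<Rightarrow> (nat \<Rightarrow> 'a \<Rightarrow> 'b::topological_space) \<Rightarrow> 'c measure \<Rightarrow> ('c \<Rightarrow> 'b) \<Rightarrow> bool"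
  where
  "conv_in_distr M Z Q Y \<longleftrightarrow>
     (\<forall>h::'b \<Rightarrow> real. continuous_on UNIV h \<and> bounded (range h) \<longrightarrow>
        (\<lambda>n. \<integral>\<omega>. h (Z n \<omega>) \<partial>M) \<longlonglongrightarrow> (\<integral>\<omega>. h (Y \<omega>) \<partial>Q))"

text \<open>The measure $e^{-C f(x)^{-\alpha}}\,\nu(dx)$ with $C = \nu\{f > 1\}$. Since
  \<open>enn2real \<infinity> = 0\<close> and \<open>0 powr _ = 0\<close>, the convention $\infty^{-\alpha} = 0$ holds; the case
  \<open>f x = 0\<close>, where \<open>powr\<close> does not give $\infty$, does not arise when \<open>f\<close> is positive on the
  space of \<open>\<nu>\<close>.\<close>

definition tail_const :: "(ereal ^ 'n \<Rightarrow> ennreal) \<Rightarrow> (ereal ^ 'n) measure \<Rightarrow> ennreal" where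
  "tail_const f \<nu> = emeasure \<nu> {z. f z > 1}"

definition limit_law ::
    "real \<Rightarrow> (ereal ^ 'n \<Rightarrow> ennreal) \<Rightarrow> (ereal ^ 'n) measure \<Rightarrow> (ereal ^ 'n) measure" where
  "limit_law \<alpha> f \<nu> =
     density \<nu>
       (\<lambda>x. ennreal (exp (- enn2real (tail_const f \<nu>) * enn2real (f x) powr (- \<alpha>))))"

end

theory Submission
  imports Defs
begin

text \<open>Write \<open>N\<close> for the limit measure and \<open>V = f\<^sup>-\<^sup>\<alpha>\<close>. Regular variation along \<open>n \<mapsto> \<lfloor>t n\<rfloor>\<close> forces
  \<open>N(\<lambda> A) = \<lambda>\<^sup>-\<^sup>\<alpha> N(A)\<close>, so \<open>N{V \<le> v} = C v\<close>. By Fubini this gives the spectral formula for \<open>C\<close>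
  (integrate over the orbits of the scaling) and total mass 1 for the law \<open>e\<^sup>-\<^sup>C\<^sup>V dN\<close> (mean of an
  exponential variable).

  For the convergence, ties are ignored: for \<open>h \<ge> 0\<close> the expectation of \<open>h(X\<^bsub>k(n)\<^esub> / a\<^sub>n)\<close> is at least
  \<open>n E[h(X / a\<^sub>n) p\<^sub>n(X)\<^sup>n\<^sup>-\<^sup>1]\<close> with \<open>p\<^sub>n(x)\<close> the probability that \<open>f(X) < f(x)\<close>. Monotonicity in the level
  makes the bound \<open>p\<^sub>n\<^sup>n \<ge> e\<^sup>-\<^sup>C\<^sup>V - \<epsilon>\<close> uniform, and continuous cutoffs supported away from \<open>D\<close> and from
  the closure of the discontinuity set yield \<open>liminf E h(X\<^bsub>k(n)\<^esub> / a\<^sub>n) \<ge> \<integral> h e\<^sup>-\<^sup>C\<^sup>V dN\<close>. Applied to \<open>B + h\<close> and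
  \<open>B - h\<close>, this lower bound suffices because the limit law has mass 1.\<close>

section \<open>Topology of $[-\infty,\infty]^d$\<close>

text \<open>The level that the competitors have to stay below is itself random, and the probability
  that they do is integrated against n times the law of X / a n, whose total mass n is unbounded.
  Convergence at each fixed level would not suffice; hence the uniform bound. Measuring levels by V
  instead of f makes it cheap: N{V <= v} is linear in v, so an even grid controls e^(-CV), and
  beyond a finite range the bound is void because e^(-CV) is below the error. Of the tails, only an
  upper bound on n P(f(X / a n) >= y) enters. This is the closed-set half of weak convergence,
  applied to the closure of {f >= y}, which adds at most points of the closed discontinuity set.
  That this set is null is used a second time: off it V is continuous where f is finite, so e^(-CV)
  times a cutoff is a legitimate test function. No tightness argument is made. What the lower bound
  ignores (ties, neighbourhoods of D, points at infinity) is seen to be negligible only through the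
  mass 1 of the limit law.\<close>

lemma compact_UNIV_ereal_vec: "compact (UNIV :: (ereal ^ 'n) set)"
proof -
  \<comment> \<open>Tychonoff applies to functions; \<open>vec_lambda\<close> is a continuous
    surjection from them onto vectors.\<close>
  have "compact_space (product_topology (\<lambda>i::'n. euclidean :: ereal topology) UNIV)"
    by (intro compact_space_product_topology[THEN iffD2]) (simp add: compact_space_def compact_UNIV)
  then have c: "compact (UNIV :: ('n \<Rightarrow> ereal) set)"
    by (simp add: compact_space_def euclidean_product_topology)
  have "continuous_on UNIV (\<lambda>g :: 'n \<Rightarrow> ereal. \<chi> i. g i)"
    by (intro continuous_intros continuous_on_product_coordinates)
  from compact_continuous_image[OF this c] show ?thesis
    by (metis UNIV_eq_I vec_lambda_eta rangeI)
qed

lemma closed_imp_compact_ereal_vec: "closed (K :: (ereal ^ 'n) set) \<Longrightarrow> compact K"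
  using closed_Int_compact[OF _ compact_UNIV_ereal_vec] by fastforce

fun ereal_arctan :: "ereal \<Rightarrow> real" where
  "ereal_arctan (ereal r) = arctan r"
| "ereal_arctan PInfty = pi / 2"
| "ereal_arctan MInfty = - (pi / 2)"

lemma ereal_arctan_infty [simp]:
  "ereal_arctan \<infinity> = pi / 2" "ereal_arctan (-\<infinity>) = - (pi / 2)"
  using ereal_arctan.simps(2,3) by (simp_all del: ereal_arctan.simps)

lemma inj_ereal_arctan: "inj ereal_arctan"
proof (rule injI)
  fix x y :: ereal
  assume "ereal_arctan x = ereal_arctan y"
  then show "x = y"
    using arctan_ubound[of "real_of_ereal x"] arctan_lbound[of "real_of_ereal x"]
      arctan_ubound[of "real_of_ereal y"] arctan_lbound[of "real_of_ereal y"]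
    by (cases x; cases y) (auto simp: arctan_eq_iff)
qed

lemma continuous_on_ereal_arctan: "continuous_on UNIV ereal_arctan"
proof -
  have "(ereal_arctan \<longlongrightarrow> ereal_arctan x) (at x)" for x
  proof (cases x)
    case (real r)
    have "(arctan \<longlongrightarrow> arctan r) (at r)"
      using isCont_arctan by (simp add: isCont_def)
    then show ?thesis by (simp add: real at_ereal filterlim_filtermap)
  next
    case PInf
    then show ?thesis
      using tendsto_arctan_at_top by (simp add: at_infty_ereal_eq_at_top filterlim_filtermap)
  next
    case MInf
    have "(at (-\<infinity>::ereal)) = at_right (-\<infinity>)"
      unfolding at_within_def by (intro arg_cong2[where f = inf] arg_cong[where f = principal]) auto
    then show ?thesis
      using tendsto_arctan_at_bot MInf by (simp add: at_right_MInf filterlim_filtermap)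
  qed
  then show ?thesis by (simp add: continuous_on_def)
qed

text \<open>\<^typ>\<open>ereal ^ 'n\<close> is not declared metrizable; distances are measured through this embedding
  into $\mathbb{R}^n$.\<close>

definition vec_arctan :: "ereal ^ 'n \<Rightarrow> real ^ 'n" where
  "vec_arctan x = (\<chi> i. ereal_arctan (x $ i))"

lemma inj_vec_arctan: "inj vec_arctan"
  using inj_ereal_arctan by (auto simp: inj_def vec_arctan_def vec_eq_iff)

lemma continuous_on_vec_arctan: "continuous_on UNIV vec_arctan"
  unfolding vec_arctan_def
  by (intro continuous_on_vec_lambda continuous_on_compose2[OF continuous_on_ereal_arctan]
      continuous_on_component continuous_on_id) auto

text \<open>\<open>d\<close>, the distance of the embedded point from the embedded complement of
  \<open>G\<close>, is positive exactly on \<open>G\<close>: the embedding is injective and the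
  image of the complement is compact, hence closed. The closed sets \<open>K\<close> inside
  \<open>G\<close> later give compact support in \<open>- D\<close> and allow gluing of functions
  that are continuous only on \<open>G\<close>.\<close>

lemma open_cutoffs_ereal_vec:
  fixes G :: "(ereal ^ 'n) set"
  assumes "open G"
  obtains c :: "nat \<Rightarrow> ereal ^ 'n \<Rightarrow> real" and K where
    "\<And>j. continuous_on UNIV (c j)" "\<And>j x. 0 \<le> c j x" "\<And>j x. c j x \<le> 1"
    "\<And>x. incseq (\<lambda>j. c j x)" "\<And>x. (\<lambda>j. c j x) \<longlonglongrightarrow> indicator G x"
    "\<And>j. closed (K j)" "\<And>j. K j \<subseteq> G" "\<And>j x. x \<notin> K j \<Longrightarrow> c j x = 0"
proof (cases "G = UNIV")
  \<comment> \<open>\<open>infdist\<close> to the empty set is 0, so the general formula would yield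
    cutoffs equal to 0 instead of 1.\<close>
  case True
  show ?thesis
    by (rule that[of "\<lambda>_ _. 1" "\<lambda>_. UNIV"]) (auto simp: True)
next
  case False
  define S where "S = vec_arctan ` (- G)"
  define d where "d x = infdist (vec_arctan x) S" for x
  have "compact (- G)"
    using assms by (intro closed_imp_compact_ereal_vec) auto
  then have "compact S"
    unfolding S_def by (intro compact_continuous_image continuous_on_subset[OF continuous_on_vec_arctan]) auto
  then have S: "closed S" "S \<noteq> {}"
    using False by (auto simp: compact_imp_closed S_def)
  have d_cont: "continuous_on UNIV d"
    unfolding d_def by (intro continuous_on_infdist continuous_on_vec_arctan)
  have d0: "d x \<ge> 0" for x by (simp add: d_def infdist_nonneg)
  have d_pos: "d x > 0 \<longleftrightarrow> x \<in> G" for x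
  proof -
    have "d x = 0 \<longleftrightarrow> vec_arctan x \<in> S"
      unfolding d_def using in_closed_iff_infdist_zero[OF S] by auto
    also have "\<dots> \<longleftrightarrow> x \<notin> G"
      by (simp add: S_def inj_image_mem_iff[OF inj_vec_arctan])
    finally show ?thesis using d0[of x] by (auto simp: less_le)
  qed
  \<comment> \<open>The shift by 1 makes \<open>c j\<close> vanish as soon as
    \<open>j * d x < 1\<close>, hence off a closed subset of \<open>G\<close>.\<close>
  define c where "c j x = max 0 (min 1 (real j * d x - 1))" for j x
  define K where "K j = {x. 1 \<le> real j * d x}" for j
  show ?thesis
  proof (rule that[of c K])
    show "continuous_on UNIV (c j)" for j
      unfolding c_def by (intro continuous_intros d_cont)
    show "closed (K j)" for j
      unfolding K_def by (intro closed_Collect_le continuous_intros d_cont)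
    show "K j \<subseteq> G" for j
      unfolding K_def using d_pos d0 by (force simp: less_le)
    show "incseq (\<lambda>j. c j x)" for x
      unfolding c_def incseq_def
      by (intro allI impI max.mono min.mono order_refl diff_right_mono mult_right_mono d0) auto
    show "(\<lambda>j. c j x) \<longlonglongrightarrow> indicator G x" for x
    proof (cases "x \<in> G")
      case True
      then have "d x > 0" by (simp add: d_pos)
      then obtain N :: nat where N: "real N * d x > 2"
        using reals_Archimedean3[of "d x"] by blast
      have "c j x = 1" if "j \<ge> N" for j
      proof -
        have "real N * d x \<le> real j * d x" using that d0 by (intro mult_right_mono) auto
        with N show ?thesis by (simp add: c_def)
      qed
      then have "\<forall>\<^sub>F j in sequentially. c j x = 1"
        by (auto simp: eventually_sequentially)
      with True show ?thesis by (simp add: tendsto_eventually)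
    next
      case False
      then have "d x = 0" using d_pos[of x] d0[of x] by auto
      then show ?thesis using False by (simp add: c_def)
    qed
  qed (auto simp: c_def K_def)
qed

lemma continuous_on_escale:
  "continuous_on ({0<..} \<times> UNIV) (\<lambda>(b, x :: ereal ^ 'n). escale b x)"
proof -
  have "continuous_on ({0<..} \<times> UNIV) (\<lambda>p :: real \<times> (ereal ^ 'n). ereal (fst p) * (snd p $ i))" for i
    unfolding continuous_on_def
  proof
    fix p :: "real \<times> (ereal ^ 'n)"
    assume "p \<in> {0<..} \<times> UNIV"
    then show "((\<lambda>p. ereal (fst p) * (snd p $ i)) \<longlongrightarrow> ereal (fst p) * (snd p $ i)) (at p within {0<..} \<times> UNIV)"
      by (intro tendsto_mult_ereal tendsto_ereal tendsto_vec_nth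
          tendsto_fst[OF tendsto_ident_at] tendsto_snd[OF tendsto_ident_at]) auto
  qed
  then show ?thesis
    unfolding escale_def case_prod_beta by (intro continuous_on_vec_lambda)
qed

lemma continuous_on_escale_const:
  assumes "s > 0"
  shows "continuous_on UNIV (escale s :: ereal ^ 'n \<Rightarrow> _)"
proof -
  have "continuous_on UNIV (\<lambda>x :: ereal ^ 'n. (s, x))"
    by (intro continuous_intros)
  from continuous_on_compose2[OF continuous_on_escale this] assms show ?thesis by auto
qed

lemma escale_evec: "escale b (evec x) = evec (b *\<^sub>R x)"
  by (simp add: escale_def evec_def vec_eq_iff)

lemma evec_0 [simp]: "evec 0 = 0"
  by (simp add: evec_def vec_eq_iff zero_ereal_def)

lemma continuous_on_evec: "continuous_on UNIV (evec :: real ^ 'n \<Rightarrow> _)"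
  unfolding evec_def by (intro continuous_on_vec_lambda continuous_on_ereal continuous_intros)

lemma evec_measurable [measurable]: "evec \<in> measurable borel (borel :: (ereal ^ 'n) measure)"
  by (intro borel_measurable_continuous_onI continuous_on_evec)

lemma range_evec: "range evec = {x :: ereal ^ 'n. \<forall>i. x $ i \<in> {-\<infinity><..<\<infinity>}}"
proof -
  have "x \<in> range evec" if "\<forall>i. x $ i \<in> {-\<infinity><..<\<infinity>}" for x :: "ereal ^ 'n"
  proof
    show "x = evec (\<chi> i. real_of_ereal (x $ i))"
      using that by (auto simp: evec_def vec_eq_iff ereal_real)
  qed auto
  then show ?thesis by (auto simp: evec_def)
qed

lemma open_range_evec: "open (range evec :: (ereal ^ 'n) set)"
  unfolding range_evec by (intro open_vector_box allI open_greaterThanLessThan)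

lemma range_evec_borel [measurable, simp]: "range evec \<in> sets borel"
  by (intro borel_open open_range_evec)

section \<open>Vague convergence on the complement of the cone\<close>

lemma nn_integral_open_cutoffs_tendsto:
  fixes N :: "(ereal ^ 'n) measure" and c :: "nat \<Rightarrow> ereal ^ 'n \<Rightarrow> real"
  assumes N: "sets N = sets borel" and "open G"
    and c: "\<And>j. continuous_on UNIV (c j)" "\<And>x. incseq (\<lambda>j. c j x)"
      "\<And>x. (\<lambda>j. c j x) \<longlonglongrightarrow> indicator G x"
  shows "(\<lambda>j. \<integral>\<^sup>+x. ennreal (c j x) \<partial>N) \<longlonglongrightarrow> emeasure N G"
proof -
  note [measurable_cong] = N
  have [measurable]: "c j \<in> borel_measurable borel" for j
    by (intro borel_measurable_continuous_onI c)
  have "(\<lambda>j. \<integral>\<^sup>+x. ennreal (c j x) \<partial>N) \<longlonglongrightarrow> (\<integral>\<^sup>+x. indicator G x \<partial>N)"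
  proof (rule nn_integral_LIMSEQ)
    show "incseq (\<lambda>j x. ennreal (c j x))"
      using c(2) by (auto simp: incseq_def le_fun_def intro!: ennreal_leI)
    show "(\<lambda>j. ennreal (c j x)) \<longlonglongrightarrow> indicator G x" for x
      using tendsto_ennrealI[OF c(3)[of x]] by (simp add: ennreal_indicator)
  qed measurable
  also have "(\<integral>\<^sup>+x. indicator G x \<partial>N) = emeasure N G"
    using \<open>open G\<close> N by (intro nn_integral_indicator) auto
  finally show ?thesis .
qed

lemma ennreal_dense_zero:
  assumes "(0 :: ennreal) < z"
  obtains y :: real where "y > 0" "ennreal y < z"
proof -
  obtain d where d: "0 < d" "d < z" using dense[OF assms] by blast
  then have "d < top" using less_le_trans by fastforce
  with d show ?thesis by (intro that[of "enn2real d"]) (auto simp: enn2real_positive_iff)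
qed

lemma integral_scale_measure_of_nat:
  fixes h :: "'a \<Rightarrow> real"
  assumes [measurable]: "h \<in> borel_measurable M"
  shows "(\<integral>x. h x \<partial>(scale_measure (of_nat n) M)) = real n * (\<integral>x. h x \<partial>M)"
proof -
  have "scale_measure (of_nat n) M = density M (\<lambda>_. ennreal (real n))"
    by (rule measure_eqI) (auto simp: emeasure_density_const ennreal_of_nat_eq_real_of_nat)
  then show ?thesis by (simp add: integral_density)
qed

locale regular_variation =
  fixes D :: "(ereal ^ 'n) set" and \<nu> :: "(ereal ^ 'n) measure"
    and P :: "'a measure" and X :: "'a \<Rightarrow> real ^ 'n"
    and \<alpha> :: real and a :: "nat \<Rightarrow> real" and \<tau> :: "ereal ^ 'n \<Rightarrow> ennreal"
  assumes D_closed: "closed D"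
    and prob_P: "prob_space P"
    and RV: "RV P X \<alpha> a D \<nu>"
    and polar: "polar_radius D \<tau>"
begin

sublocale P: prob_space P by (rule prob_P)

text \<open>\<nu> lives on the subspace \<open>- D\<close>. Extended by zero to the whole compact
  space, it can be handled with Borel measurability and with globally continuous, hence bounded,
  functions.\<close>

definition N :: "(ereal ^ 'n) measure" where
  "N = distr \<nu> borel (\<lambda>x. x)"

definition scaled :: "nat \<Rightarrow> 'a \<Rightarrow> ereal ^ 'n" where
  "scaled n \<omega> = evec ((1 / a n) *\<^sub>R X \<omega>)"

text \<open>As \<open>{\<tau> = 0} = D\<close> and the whole space is compact, vanishing on some \<open>{\<tau> < \<delta>}\<close> means having compact
  support in \<open>- D\<close>.\<close>

definition test_fun :: "(ereal ^ 'n \<Rightarrow> real) \<Rightarrow> bool" where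
  "test_fun h \<longleftrightarrow> continuous_on UNIV h \<and> (\<exists>\<delta>>0. \<forall>x. \<tau> x < ennreal \<delta> \<longrightarrow> h x = 0)"

lemma alpha_pos: "\<alpha> > 0" and X_measurable [measurable]: "X \<in> borel_measurable P"
  and a_pos: "n \<ge> 1 \<Longrightarrow> a n > 0"
  and sets_nu: "sets \<nu> = sets (restrict_space borel (- D))"
  using RV by (auto simp: RV_def radon_measure_on_def)

lemma space_nu: "space \<nu> = - D"
  using sets_eq_imp_space_eq[OF sets_nu] by (simp add: space_restrict_space)

lemma tau_cont: "continuous_on UNIV \<tau>" and tau_eq_0: "\<tau> x = 0 \<longleftrightarrow> x \<in> D"
  and tau_evec: "\<tau> (evec y) < \<infinity>"
  and tau_escale: "c > 0 \<Longrightarrow> \<tau> (escale c x) = ennreal c * \<tau> x"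
  using polar by (auto simp: polar_radius_def)

lemma borel_D [measurable]: "D \<in> sets borel"
  using D_closed by simp

lemma tau_measurable [measurable]: "\<tau> \<in> borel_measurable borel"
  by (intro borel_measurable_continuous_onI tau_cont)

lemma id_measurable_nu: "(\<lambda>x. x) \<in> measurable \<nu> borel"
  unfolding measurable_cong_sets[OF sets_nu refl]
  by (rule measurable_restrict_space1) simp

lemma measurable_nuI: "g \<in> measurable borel M \<Longrightarrow> g \<in> measurable \<nu> M"
  using measurable_compose[OF id_measurable_nu] .

lemma sets_N [simp, measurable_cong]: "sets N = sets borel" and space_N [simp]: "space N = UNIV"
  by (auto simp: N_def)

lemma emeasure_N: "A \<in> sets borel \<Longrightarrow> emeasure N A = emeasure \<nu> (A - D)"
  using id_measurable_nu by (simp add: N_def emeasure_distr space_nu Diff_eq)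

lemma emeasure_N_D: "emeasure N D = 0"
  by (simp add: emeasure_N)

lemma nn_integral_N: "h \<in> borel_measurable borel \<Longrightarrow> (\<integral>\<^sup>+x. h x \<partial>N) = (\<integral>\<^sup>+x. h x \<partial>\<nu>)"
  using id_measurable_nu by (simp add: N_def nn_integral_distr)

lemma integral_N: "(h :: _ \<Rightarrow> real) \<in> borel_measurable borel \<Longrightarrow> (\<integral>x. h x \<partial>N) = (\<integral>x. h x \<partial>\<nu>)"
  using id_measurable_nu by (simp add: N_def integral_distr)

text \<open>\<open>RV\<close> gives no mass to points outside \<open>D\<close> with an infinite
  coordinate, and \<open>N\<close> none to \<open>D\<close>. Later identities between powers of
  \<open>f\<close> and \<open>\<tau>\<close> are therefore checked on \<open>range evec - D\<close>
  only, where both are finite and positive.\<close>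

lemma AE_N_proper: "AE x in N. x \<in> range evec - D"
proof (rule AE_I)
  show "{x \<in> space N. \<not> x \<in> range evec - D} \<subseteq> - range evec \<union> D" by auto
  show *: "- range evec \<union> D \<in> sets N"
    by (simp add: borel_comp)
  have "- range evec \<union> D - D = - D - range evec" by auto
  then show "emeasure N (- range evec \<union> D) = 0"
    using RV * by (subst emeasure_N) (auto simp: RV_def)
qed

text \<open>\<open>\<tau>\<close> attains its minimum on \<open>K\<close>, which is nonzero because
  \<open>\<tau>\<close> vanishes only on \<open>D\<close>. Topological separation from
  \<open>D\<close> thus becomes a bound on the radius.\<close>

lemma compact_away:
  assumes "compact K" "K \<subseteq> - D"
  obtains \<delta> :: real where "\<delta> > 0" "\<And>x. x \<in> K \<Longrightarrow> ennreal \<delta> \<le> \<tau> x"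
proof (cases "K = {}")
  case True then show ?thesis by (intro that[of 1]) auto
next
  case False
  obtain x where x: "x \<in> K" "\<And>y. y \<in> K \<Longrightarrow> \<tau> x \<le> \<tau> y"
    using continuous_attains_inf[OF assms(1) False continuous_on_subset[OF tau_cont]] by auto
  then have "\<tau> x > 0" using assms tau_eq_0[of x] by (auto simp: zero_less_iff_neq_zero)
  then obtain d where "d > 0" "ennreal d < \<tau> x" using ennreal_dense_zero by blast
  then show ?thesis using x(2) by (intro that[of d]) (auto intro: less_imp_le less_le_trans)
qed

lemma away_compact: "compact {x. ennreal \<delta> \<le> \<tau> x}"
  by (intro closed_imp_compact_ereal_vec closed_Collect_le tau_cont continuous_intros)

lemma emeasure_N_away: "\<delta> > 0 \<Longrightarrow> emeasure N {x. ennreal \<delta> \<le> \<tau> x} < \<infinity>"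
proof -
  assume \<delta>: "\<delta> > 0"
  have "{x. ennreal \<delta> \<le> \<tau> x} \<subseteq> - D" using tau_eq_0 \<delta> by force
  then have "{x. ennreal \<delta> \<le> \<tau> x} - D = {x. ennreal \<delta> \<le> \<tau> x}" by auto
  with \<open>{x. ennreal \<delta> \<le> \<tau> x} \<subseteq> - D\<close> show ?thesis
    using RV away_compact[of \<delta>] by (subst emeasure_N) (auto simp: RV_def radon_measure_on_def)
qed

lemma scaled_measurable [measurable]: "scaled n \<in> measurable P borel"
  unfolding scaled_def by measurable

lemma test_fun_measurable [measurable_dest]: "test_fun h \<Longrightarrow> h \<in> borel_measurable borel"
  by (auto simp: test_fun_def intro: borel_measurable_continuous_onI)

lemma continuous_bounded:
  fixes h :: "ereal ^ 'n \<Rightarrow> real"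
  assumes "continuous_on UNIV h"
  obtains B where "B > 0" "\<And>x. \<bar>h x\<bar> \<le> B"
proof -
  have "bounded (range h)"
    by (intro compact_imp_bounded compact_continuous_image assms compact_UNIV_ereal_vec)
  then show ?thesis using that by (auto simp: bounded_pos)
qed

lemma test_fun_integrable:
  assumes "test_fun h"
  shows "integrable N h"
proof -
  obtain \<delta> where \<delta>: "\<delta> > 0" "\<And>x. \<tau> x < ennreal \<delta> \<Longrightarrow> h x = 0"
    using assms by (auto simp: test_fun_def)
  obtain B where "\<And>x. \<bar>h x\<bar> \<le> B"
    using assms continuous_bounded by (metis test_fun_def)
  then show ?thesis
    using assms emeasure_N_away[OF \<delta>(1)] \<delta>(2)
    by (intro integrableI_bounded_set[of "{x. ennreal \<delta> \<le> \<tau> x}" _ _ B]) (auto simp: not_le)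
qed

lemma continuous_P_integrable:
  fixes h :: "ereal ^ 'n \<Rightarrow> real"
  assumes "continuous_on UNIV h" and [measurable]: "g \<in> measurable P borel"
  shows "integrable P (\<lambda>\<omega>. h (g \<omega>))"
proof -
  have [measurable]: "h \<in> borel_measurable borel"
    by (intro borel_measurable_continuous_onI assms)
  obtain B where "\<And>x. \<bar>h x\<bar> \<le> B"
    using assms continuous_bounded by metis
  then show ?thesis by (intro P.integrable_const_bound[of _ B]) auto
qed

text \<open>A test function vanishes on \<open>D\<close>, so restricting the law of the scaled
  vector to \<open>- D\<close> does not change its integral; the support condition of
  \<open>vague_conv_on\<close> holds with the compact set
  \<open>{x. ennreal \<delta> \<le> \<tau> x}\<close>.\<close>

lemma vague:
  assumes "test_fun h"
  shows "(\<lambda>n. real n * (\<integral>\<omega>. h (scaled n \<omega>) \<partial>P)) \<longlonglongrightarrow> (\<integral>x. h x \<partial>N)"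
proof -
  note [measurable] = test_fun_measurable[OF assms]
  obtain \<delta> where \<delta>: "\<delta> > 0" "\<And>x. \<tau> x < ennreal \<delta> \<Longrightarrow> h x = 0"
    using assms by (auto simp: test_fun_def)
  have h0: "h x = 0" if "x \<in> D" for x
    using that \<delta> tau_eq_0[of x] by auto
  have "{x. ennreal \<delta> \<le> \<tau> x} \<subseteq> - D" using tau_eq_0 \<delta> by force
  then have "(\<exists>K. compact K \<and> K \<subseteq> - D \<and> (\<forall>x\<in>- D - K. h x = 0))"
    using away_compact[of \<delta>] \<delta>(2) by (intro exI[of _ "{x. ennreal \<delta> \<le> \<tau> x}"]) (auto simp: not_le)
  moreover have "continuous_on (- D) h"
    using assms by (auto simp: test_fun_def intro: continuous_on_subset)
  ultimately have *: "(\<lambda>n. \<integral>x. h x \<partial>(scale_measure (of_nat n)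
          (restrict_space (distr P borel (scaled n)) (- D)))) \<longlonglongrightarrow> (\<integral>x. h x \<partial>\<nu>)"
    using RV unfolding RV_def vague_conv_on_def scaled_def by blast
  have "(\<integral>x. h x \<partial>(scale_measure (of_nat n) (restrict_space (distr P borel (scaled n)) (- D))))
      = real n * (\<integral>\<omega>. h (scaled n \<omega>) \<partial>P)" for n
  proof -
    have "(\<integral>x. h x \<partial>(restrict_space (distr P borel (scaled n)) (- D)))
      = (\<integral>x. h x \<partial>(distr P borel (scaled n)))"
      using D_closed
      by (subst integral_restrict_space) (auto intro!: Bochner_Integration.integral_cong simp: indicator_def h0)
    then show ?thesis
      by (subst integral_scale_measure_of_nat)
        (auto simp: integral_distr intro!: measurable_restrict_space1)
  qed
  with * show ?thesis by (simp add: integral_N)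
qed

end

section \<open>Homogeneity of the limit measure\<close>

text \<open>Tube lemma: the slice at the factor s is a copy of the compact whole space, so the open
  set around it where the difference is small contains a product neighbourhood. This gives the
  uniformity in x needed to replace a converging factor by its limit.\<close>

lemma eventually_uniform_escale:
  fixes h :: "ereal ^ 'n \<Rightarrow> real"
  assumes h: "continuous_on UNIV h" and s: "s > 0" and e: "e > 0"
  shows "\<forall>\<^sub>F b in nhds s. \<forall>x. \<bar>h (escale b x) - h (escale s x)\<bar> < e"
proof -
  define g where "g p = \<bar>h ((\<lambda>(b, x). escale b x) p) - h (escale s (snd p))\<bar>" for p :: "real \<times> (ereal ^ 'n)"
  have "continuous_on ({0<..} \<times> UNIV) g"
    unfolding g_def
    by (intro continuous_intros continuous_on_compose2[OF h] continuous_on_escale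
        continuous_on_compose2[OF continuous_on_escale_const[OF s]]) auto
  then have W: "open (g -` {..<e} \<inter> ({0<..} \<times> UNIV))"
    by (intro continuous_on_open_vimage[THEN iffD1, rule_format] open_Times) auto
  have "\<exists>U V. openin euclidean U \<and> openin euclidean V \<and> s \<in> U \<and> UNIV \<subseteq> V \<and>
      U \<times> V \<subseteq> g -` {..<e} \<inter> ({0<..} \<times> UNIV)"
    using W s e compact_UNIV_ereal_vec
    by (intro tube_lemma_right) (auto simp: g_def)
  then show ?thesis
    unfolding eventually_nhds g_def by (fastforce simp: subset_iff)
qed

lemma nat_floor_mult_div_tendsto:
  assumes "t > 0"
  shows "(\<lambda>n. real (nat \<lfloor>t * real n\<rfloor>) / real n) \<longlonglongrightarrow> t"
proof (rule tendsto_sandwich)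
  show "(\<lambda>n. t - 1 / real n) \<longlonglongrightarrow> t"
    using tendsto_diff[OF tendsto_const[of t] lim_1_over_n] by simp
  show "\<forall>\<^sub>F n in sequentially. t - 1 / real n \<le> real (nat \<lfloor>t * real n\<rfloor>) / real n"
    using eventually_gt_at_top[of 0]
  proof eventually_elim
    case (elim n)
    have "t * real n - 1 \<le> real (nat \<lfloor>t * real n\<rfloor>)" by linarith
    then have "(t * real n - 1) / real n \<le> real (nat \<lfloor>t * real n\<rfloor>) / real n"
      by (rule divide_right_mono) simp
    with elim show ?case by (simp add: diff_divide_distrib)
  qed
  show "\<forall>\<^sub>F n in sequentially. real (nat \<lfloor>t * real n\<rfloor>) / real n \<le> t"
    using eventually_gt_at_top[of 0]
  proof eventually_elim
    case (elim n)
    have "real (nat \<lfloor>t * real n\<rfloor>) \<le> t * real n" using assms by (simp add: of_nat_floor)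
    with elim show ?case by (simp add: field_simps)
  qed
qed simp

lemma filterlim_nat_floor_mult:
  assumes "t > 0"
  shows "filterlim (\<lambda>n. nat \<lfloor>t * real n\<rfloor>) at_top sequentially"
  using assms
  by (intro filterlim_compose[OF filterlim_nat_sequentially] filterlim_compose[OF filterlim_floor_sequentially]
      filterlim_tendsto_pos_mult_at_top[OF tendsto_const] filterlim_real_sequentially)

context regular_variation
begin

lemma escale_mem_D_iff: "c > 0 \<Longrightarrow> escale c x \<in> D \<longleftrightarrow> x \<in> D"
  using tau_escale[of c x] by (simp add: tau_eq_0[symmetric])

lemma tau_less_divide:
  assumes "s > 0" "\<tau> x < ennreal (\<delta> / s)"
  shows "\<tau> (escale s x) < ennreal \<delta>"
proof -
  have "ennreal s * \<tau> x < ennreal s * ennreal (\<delta> / s)"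
    using assms by (intro ennreal_mult_strict_left_mono) auto
  with assms show ?thesis by (simp add: tau_escale ennreal_mult'[symmetric])
qed

lemma test_fun_escale:
  assumes "test_fun h" "s > 0"
  shows "test_fun (\<lambda>x. h (escale s x))"
proof -
  obtain \<delta> where \<delta>: "\<delta> > 0" "\<And>x. \<tau> x < ennreal \<delta> \<Longrightarrow> h x = 0" and h: "continuous_on UNIV h"
    using assms by (auto simp: test_fun_def)
  have "continuous_on UNIV (\<lambda>x. h (escale s x))"
    by (intro continuous_on_compose2[OF h] continuous_on_escale_const assms) auto
  moreover have "\<delta> / s > 0" "\<And>x. \<tau> x < ennreal (\<delta> / s) \<Longrightarrow> h (escale s x) = 0"
    using \<delta> \<open>s > 0\<close> by (auto intro: tau_less_divide)
  ultimately show ?thesis unfolding test_fun_def by blast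
qed

lemma bump:
  assumes "\<delta> > 0"
  obtains \<phi> where "test_fun \<phi>" "\<And>x. 0 \<le> \<phi> x" "\<And>x. ennreal \<delta> \<le> \<tau> x \<Longrightarrow> \<phi> x = 1"
proof -
  \<comment> \<open>\<open>enn2real\<close> is discontinuous at infinity, a value that
    \<open>\<tau>\<close> may take; the cut at \<delta> keeps the argument finite and leaves
    \<open>r x = \<delta>\<close> wherever the radius is at least \<delta>.\<close>
  define r where "r x = enn2real (min (ennreal \<delta>) (\<tau> x))" for x
  have "continuous_on UNIV (\<lambda>x. min (ennreal \<delta>) (\<tau> x))"
    by (intro continuous_intros tau_cont)
  then have "continuous_on UNIV r"
    unfolding r_def continuous_on_def
    by (auto intro!: tendsto_enn2real simp: ennreal_enn2real[OF min.strict_coboundedI1])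
  then have "continuous_on UNIV (\<lambda>x. max 0 (2 * r x / \<delta> - 1))"
    using assms by (intro continuous_intros) auto
  moreover have "max 0 (2 * r x / \<delta> - 1) = 0" if "\<tau> x < ennreal (\<delta> / 2)" for x
  proof -
    have "r x \<le> \<delta> / 2"
      using that assms unfolding r_def by (intro enn2real_leI) (auto simp: min_le_iff_disj)
    then show ?thesis using assms by (simp add: field_simps)
  qed
  ultimately have "test_fun (\<lambda>x. max 0 (2 * r x / \<delta> - 1))"
    using assms half_gt_zero unfolding test_fun_def by blast
  then show ?thesis
    by (rule that) (use assms in \<open>auto simp: r_def min_absorb1\<close>)
qed

section \<open>Scaling of the limit measure, from test functions to sets\<close>

lemma scaled_rescale:
  assumes "n \<ge> 1" "m \<ge> 1"
  shows "scaled m \<omega> = escale (a n / a m) (scaled n \<omega>)"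
  using a_pos[OF assms(1)] a_pos[OF assms(2)] by (simp add: scaled_def escale_evec)

text \<open>The values at the factors \<open>b n\<close> and s differ by at most
  \<open>e * \<phi>\<close>, where \<phi> is 1 wherever either can be nonzero. Integrated against n
  times the law, this is at most e times a convergent sequence, so uniform smallness survives the
  unbounded total mass.\<close>

lemma vague_perturbed:
  assumes h: "test_fun h" and s: "s > 0" and b: "b \<longlonglongrightarrow> s"
  shows "(\<lambda>n. real n * (\<integral>\<omega>. h (escale (b n) (scaled n \<omega>)) \<partial>P)) \<longlonglongrightarrow> (\<integral>x. h (escale s x) \<partial>N)"
proof -
  obtain \<delta> where \<delta>: "\<delta> > 0" "\<And>x. \<tau> x < ennreal \<delta> \<Longrightarrow> h x = 0" and hc: "continuous_on UNIV h"
    using h by (auto simp: test_fun_def)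
  \<comment> \<open>Eventually \<open>b n < 2 * s\<close>; then \<open>escale (b n) x\<close> and
    \<open>escale s x\<close> both have radius below \<delta> once the radius of x is below
    \<open>\<delta> / (2 * s)\<close>.\<close>
  obtain \<phi> where \<phi>: "test_fun \<phi>" "\<And>x. 0 \<le> \<phi> x" "\<And>x. ennreal (\<delta> / (2 * s)) \<le> \<tau> x \<Longrightarrow> \<phi> x = 1"
    using bump[of "\<delta> / (2 * s)"] \<delta> s by auto
  have hI: "integrable P (\<lambda>\<omega>. h (escale b (scaled n \<omega>)))" if "b > 0" for b n
    using continuous_P_integrable[of "\<lambda>x. h (escale b x)" "scaled n"] test_fun_escale[OF h that]
    by (auto simp: test_fun_def)
  have \<phi>I: "integrable P (\<lambda>\<omega>. \<phi> (scaled n \<omega>))" for n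
    using continuous_P_integrable[of \<phi> "scaled n"] \<phi> by (auto simp: test_fun_def)
  have "(\<lambda>n. real n * (\<integral>\<omega>. h (escale (b n) (scaled n \<omega>)) \<partial>P) - real n * (\<integral>\<omega>. h (escale s (scaled n \<omega>)) \<partial>P)) \<longlonglongrightarrow> 0"
  proof (rule LIMSEQ_I)
    fix r :: real assume r: "r > 0"
    define \<Phi> where "\<Phi> = (\<integral>x. \<phi> x \<partial>N)"
    have \<Phi>: "\<Phi> \<ge> 0" unfolding \<Phi>_def using \<phi> by (intro Bochner_Integration.integral_nonneg) auto
    define e where "e = r / (\<Phi> + 1)"
    have e: "e > 0" using r \<Phi> by (simp add: e_def)
    have ev1: "\<forall>\<^sub>F n in sequentially. real n * (\<integral>\<omega>. \<phi> (scaled n \<omega>) \<partial>P) < \<Phi> + 1"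
      using order_tendstoD(2)[OF vague[OF \<phi>(1)]] unfolding \<Phi>_def by simp
    have ev2: "\<forall>\<^sub>F n in sequentially. \<forall>x. \<bar>h (escale (b n) x) - h (escale s x)\<bar> < e"
      using filterlim_iff[THEN iffD1, OF b, rule_format, OF eventually_uniform_escale[OF hc s e]] .
    have ev3: "\<forall>\<^sub>F n in sequentially. 0 < b n \<and> b n < 2 * s"
      using order_tendstoD(1)[OF b s] order_tendstoD(2)[OF b, of "2 * s"] s by (simp add: eventually_conj)
    have "\<forall>\<^sub>F n in sequentially. \<bar>real n * (\<integral>\<omega>. h (escale (b n) (scaled n \<omega>)) \<partial>P) - real n * (\<integral>\<omega>. h (escale s (scaled n \<omega>)) \<partial>P)\<bar> < r"
      using ev1 ev2 ev3
    proof eventually_elim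
      case (elim n)
      have le: "\<bar>h (escale (b n) x) - h (escale s x)\<bar> \<le> e * \<phi> x" for x
      proof (cases "ennreal (\<delta> / (2 * s)) \<le> \<tau> x")
        case True then show ?thesis using elim \<phi>(3)[of x] by (auto intro: less_imp_le)
      next
        case False
        have "\<delta> / (2 * s) \<le> \<delta> / b n" "\<delta> / (2 * s) \<le> \<delta> / s"
          using elim \<delta>(1) s by (auto simp: field_simps)
        then have "\<tau> x < ennreal (\<delta> / b n)" "\<tau> x < ennreal (\<delta> / s)"
          using False ennreal_leI by (meson not_le order_less_le_trans)+
        then have "h (escale (b n) x) = 0" "h (escale s x) = 0"
          using \<delta>(2) tau_less_divide elim s by blast+
        then show ?thesis using e \<phi>(2) by simp
      qed
      have "\<bar>(\<integral>\<omega>. h (escale (b n) (scaled n \<omega>)) \<partial>P) - (\<integral>\<omega>. h (escale s (scaled n \<omega>)) \<partial>P)\<bar>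
        = \<bar>\<integral>\<omega>. h (escale (b n) (scaled n \<omega>)) - h (escale s (scaled n \<omega>)) \<partial>P\<bar>"
        using elim s by (subst Bochner_Integration.integral_diff) (auto intro: hI)
      also have "\<dots> \<le> (\<integral>\<omega>. \<bar>h (escale (b n) (scaled n \<omega>)) - h (escale s (scaled n \<omega>))\<bar> \<partial>P)"
        by (rule integral_abs_bound)
      also have "\<dots> \<le> (\<integral>\<omega>. e * \<phi> (scaled n \<omega>) \<partial>P)"
        using elim s le by (intro integral_mono integrable_abs Bochner_Integration.integrable_diff hI integrable_mult_right \<phi>I) auto
      also have "\<dots> = e * (\<integral>\<omega>. \<phi> (scaled n \<omega>) \<partial>P)" by simp
      finally have "real n * \<bar>(\<integral>\<omega>. h (escale (b n) (scaled n \<omega>)) \<partial>P) - (\<integral>\<omega>. h (escale s (scaled n \<omega>)) \<partial>P)\<bar>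
        \<le> real n * (e * (\<integral>\<omega>. \<phi> (scaled n \<omega>) \<partial>P))" by (intro mult_left_mono) auto
      also have "\<dots> = e * (real n * (\<integral>\<omega>. \<phi> (scaled n \<omega>) \<partial>P))" by simp
      also have "\<dots> < e * (\<Phi> + 1)" using elim e by (intro mult_strict_left_mono) auto
      also have "\<dots> = r" using \<Phi> by (simp add: e_def)
      finally show ?case by (simp add: abs_mult right_diff_distrib[symmetric])
    qed
    then show "\<exists>no. \<forall>n\<ge>no. norm (real n * (\<integral>\<omega>. h (escale (b n) (scaled n \<omega>)) \<partial>P) - real n * (\<integral>\<omega>. h (escale s (scaled n \<omega>)) \<partial>P) - 0) < r"
      by (simp add: eventually_sequentially)
  qed
  from tendsto_add[OF this vague[OF test_fun_escale[OF h s]]] show ?thesis by simp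
qed

text \<open>The integral of h at index \<open>m n\<close>, about t n, is evaluated twice. Since
  \<open>m n\<close> tends to infinity, vague convergence gives the integral of h; rewritten at
  index n with the factor \<open>a n / a (m n)\<close>, which tends to s, it is a perturbed
  integral. The ratio of \<open>m n\<close> to n accounts for the power of s.\<close>

lemma integral_escale:
  assumes h: "test_fun h" and s: "s > 0"
  shows "(\<integral>x. h (escale s x) \<partial>N) = s powr \<alpha> * (\<integral>x. h x \<partial>N)"
proof -
  \<comment> \<open>Chosen so that \<open>t powr (1 / \<alpha>)\<close>, the limit of
    \<open>a (m n) / a n\<close>, is \<open>inverse s\<close>.\<close>
  define t where "t = s powr (-\<alpha>)"
  define m where "m n = nat \<lfloor>t * real n\<rfloor>" for n
  have t: "t > 0" using s by (simp add: t_def)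
  have m: "filterlim m at_top sequentially"
    unfolding m_def using t by (rule filterlim_nat_floor_mult)
  have m1: "\<forall>\<^sub>F n in sequentially. m n \<ge> 1"
    using m by (simp add: filterlim_at_top)
  have "(\<lambda>n. a (m n) / a n) \<longlonglongrightarrow> t powr (1 / \<alpha>)"
    using RV t unfolding RV_def reg_varying_seq_def m_def by blast
  moreover have "t powr (1 / \<alpha>) = inverse s"
    using s alpha_pos unfolding t_def powr_powr by (simp add: powr_neg_one inverse_eq_divide)
  ultimately have "(\<lambda>n. a (m n) / a n) \<longlonglongrightarrow> inverse s" by simp
  from tendsto_inverse[OF this] s have b: "(\<lambda>n. a n / a (m n)) \<longlonglongrightarrow> s" by simp
  have "(\<lambda>n. real (m n) * (\<integral>\<omega>. h (scaled (m n) \<omega>) \<partial>P)) \<longlonglongrightarrow> (\<integral>x. h x \<partial>N)"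
    using filterlim_compose[OF vague[OF h] m] .
  moreover have "(\<lambda>n. inverse (real (m n) / real n)) \<longlonglongrightarrow> inverse t"
    unfolding m_def using t by (intro tendsto_inverse nat_floor_mult_div_tendsto) auto
  ultimately have "(\<lambda>n. inverse (real (m n) / real n) * (real (m n) * (\<integral>\<omega>. h (scaled (m n) \<omega>) \<partial>P)))
      \<longlonglongrightarrow> inverse t * (\<integral>x. h x \<partial>N)" by (intro tendsto_mult)
  moreover have "\<forall>\<^sub>F n in sequentially.
      inverse (real (m n) / real n) * (real (m n) * (\<integral>\<omega>. h (scaled (m n) \<omega>) \<partial>P))
      = real n * (\<integral>\<omega>. h (escale (a n / a (m n)) (scaled n \<omega>)) \<partial>P)"
    using m1 eventually_ge_at_top[of 1]
  proof eventually_elim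
    case (elim n)
    then show ?case by (simp add: scaled_rescale[OF elim(2,1)])
  qed
  ultimately have "(\<lambda>n. real n * (\<integral>\<omega>. h (escale (a n / a (m n)) (scaled n \<omega>)) \<partial>P))
      \<longlonglongrightarrow> inverse t * (\<integral>x. h x \<partial>N)"
    by (rule Lim_transform_eventually)
  from LIMSEQ_unique[OF vague_perturbed[OF h s b] this] show ?thesis
    using s by (simp add: t_def powr_minus)
qed

text \<open>Uniqueness from open sets needs finiteness, and both measures may be infinite near
  \<open>D\<close>. It is applied to the restrictions to \<open>U i\<close>, which are finite; the
  \<open>U i\<close> exhaust \<open>- D\<close>, where all the mass lies.\<close>

lemma measure_eqI_away:
  assumes [simp]: "sets M1 = sets borel" "sets M2 = sets borel"
    and D: "emeasure M1 D = 0" "emeasure M2 D = 0"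
    and eq: "\<And>G. open G \<Longrightarrow> G \<subseteq> - D \<Longrightarrow> emeasure M1 G = emeasure M2 G"
    and fin: "\<And>\<delta>. \<delta> > 0 \<Longrightarrow> emeasure M1 {x. ennreal \<delta> \<le> \<tau> x} < \<infinity>"
  shows "M1 = M2"
proof (rule measure_eqI)
  define U where "U i = {x. ennreal (1 / Suc i) < \<tau> x}" for i
  have U_open: "open (U i)" for i
    unfolding U_def by (intro open_Collect_less tau_cont continuous_intros)
  have U_D: "U i \<subseteq> - D" for i using tau_eq_0 by (force simp: U_def)
  have incU: "incseq U"
    unfolding U_def incseq_def
    by (auto elim!: le_less_trans[rotated] intro!: ennreal_leI divide_left_mono)
  have UN: "(\<Union>i. U i) = - D"
  proof
    show "- D \<subseteq> (\<Union>i. U i)"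
    proof
      fix x assume "x \<in> - D"
      then obtain \<delta> where \<delta>: "\<delta> > 0" "ennreal \<delta> \<le> \<tau> x"
        using compact_away[of "{x}"] by auto
      then obtain i where "1 / Suc i < \<delta>" using nat_approx_posE by metis
      then have "ennreal (1 / Suc i) < ennreal \<delta>" by (intro ennreal_lessI \<delta>)
      with \<delta> show "x \<in> (\<Union>i. U i)" unfolding U_def by (auto intro: less_le_trans)
    qed
  qed (use U_D in auto)
  have restr: "density M1 (indicator (U i)) = density M2 (indicator (U i))" for i
  proof (rule measure_eqI_generator_eq[where E = "{S. open S}" and \<Omega> = UNIV and A = "\<lambda>_. UNIV"])
    have "emeasure M1 (U i) \<le> emeasure M1 {x. ennreal (1 / Suc i) \<le> \<tau> x}"
      by (intro emeasure_mono) (auto simp: U_def)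
    also have "\<dots> < \<infinity>" using fin[of "1 / Suc i"] by simp
    finally have "emeasure M1 (U i) < \<infinity>" .
    then show "emeasure (density M1 (indicator (U i))) UNIV \<noteq> \<infinity>"
      using U_open[of i] by (subst emeasure_restricted) auto
    show "emeasure (density M1 (indicator (U i))) S = emeasure (density M2 (indicator (U i))) S"
      if "S \<in> {S. open S}" for S
      using that U_open[of i] U_D[of i] by (subst (1 2) emeasure_restricted) (auto intro!: eq)
  qed (auto simp: Int_stable_def borel_def sets_measure_of)
  fix A assume "A \<in> sets M1"
  then have A [measurable]: "A \<in> sets borel" by simp
  have [measurable]: "U i \<in> sets borel" for i using U_open by simp
  have lim: "(\<lambda>i. emeasure M' (U i \<inter> A)) \<longlonglongrightarrow> emeasure M' A"
    if "sets M' = sets borel" "emeasure M' D = 0" for M'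
  proof -
    note [measurable_cong] = that(1)
    have "(\<lambda>i. emeasure M' (U i \<inter> A)) \<longlonglongrightarrow> emeasure M' (\<Union>i. U i \<inter> A)"
      using incU by (intro Lim_emeasure_incseq) (auto simp: incseq_def that intro!: sets.Int)
    also have "(\<Union>i. U i \<inter> A) = A - D" using UN by auto
    also have "emeasure M' (A - D) = emeasure M' A"
      using that by (intro emeasure_Diff_null_set) (auto simp: null_sets_def)
    finally show ?thesis .
  qed
  have "emeasure M1 (U i \<inter> A) = emeasure M2 (U i \<inter> A)" for i
    using arg_cong[OF restr[of i], of "\<lambda>M. emeasure M A"] by (subst (asm) (1 2) emeasure_restricted) auto
  with lim[OF assms(1) D(1)] lim[OF assms(2) D(2)] show "emeasure M1 A = emeasure M2 A"
    by (simp add: LIMSEQ_unique)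
qed simp

lemma open_test_cutoffs:
  assumes "open G" "G \<subseteq> - D"
  obtains c :: "nat \<Rightarrow> ereal ^ 'n \<Rightarrow> real" and K where
    "\<And>j. test_fun (c j)" "\<And>j x. 0 \<le> c j x" "\<And>j x. c j x \<le> 1"
    "\<And>x. incseq (\<lambda>j. c j x)" "\<And>x. (\<lambda>j. c j x) \<longlonglongrightarrow> indicator G x"
    "\<And>j. closed (K j)" "\<And>j. K j \<subseteq> G" "\<And>j x. x \<notin> K j \<Longrightarrow> c j x = 0"
proof -
  obtain c :: "nat \<Rightarrow> ereal ^ 'n \<Rightarrow> real" and K where
    c: "\<And>j. continuous_on UNIV (c j)" "\<And>j x. 0 \<le> c j x" "\<And>j x. c j x \<le> 1"
    "\<And>x. incseq (\<lambda>j. c j x)" "\<And>x. (\<lambda>j. c j x) \<longlonglongrightarrow> indicator G x"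
    "\<And>j. closed (K j)" "\<And>j. K j \<subseteq> G" "\<And>j x. x \<notin> K j \<Longrightarrow> c j x = 0"
    using open_cutoffs_ereal_vec[OF assms(1)] by blast
  have "test_fun (c j)" for j
  proof -
    obtain \<delta> where "\<delta> > 0" "\<And>x. x \<in> K j \<Longrightarrow> ennreal \<delta> \<le> \<tau> x"
      using compact_away[of "K j"] closed_imp_compact_ereal_vec c(6,7) assms(2) by (metis order_trans)
    then show ?thesis using c(1,8) unfolding test_fun_def by (metis not_le)
  qed
  then show ?thesis using c by (intro that[of c K])
qed

lemma escale_measurable [measurable]: "s > 0 \<Longrightarrow> escale s \<in> measurable borel (borel :: (ereal ^ 'n) measure)"
  by (intro borel_measurable_continuous_onI continuous_on_escale_const)

text \<open>On an open subset of \<open>- D\<close> both sides are increasing limits of integrals of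
  test functions, for which the scaling is known. Test functions are integrable, which permits
  passing between \<open>nn_integral\<close> and the Bochner integral.\<close>

lemma distr_escale:
  assumes s: "s > 0"
  shows "distr N borel (escale s) = scale_measure (ennreal (s powr \<alpha>)) N"
proof (rule measure_eqI_away)
  note [measurable] = escale_measurable[OF s]
  show "emeasure (distr N borel (escale s)) D = 0"
  proof -
    have "escale s -` D = D" using escale_mem_D_iff[OF s] by auto
    then show ?thesis by (subst emeasure_distr) (auto simp: emeasure_N_D)
  qed
  show "emeasure (scale_measure (ennreal (s powr \<alpha>)) N) D = 0"
    by (simp add: emeasure_N_D)
  show "emeasure (distr N borel (escale s)) {x. ennreal \<delta> \<le> \<tau> x} < \<infinity>" if "\<delta> > 0" for \<delta>
  proof -
    have "escale s -` {x. ennreal \<delta> \<le> \<tau> x} \<subseteq> {x. ennreal (\<delta> / s) \<le> \<tau> x}"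
      using tau_less_divide[OF s] by (auto simp: not_less[symmetric])
    then have "emeasure N (escale s -` {x. ennreal \<delta> \<le> \<tau> x}) \<le> emeasure N {x. ennreal (\<delta> / s) \<le> \<tau> x}"
      by (intro emeasure_mono) auto
    also have "\<dots> < \<infinity>" using that s by (intro emeasure_N_away) auto
    finally show ?thesis by (simp add: emeasure_distr)
  qed
  show "emeasure (distr N borel (escale s)) G = emeasure (scale_measure (ennreal (s powr \<alpha>)) N) G"
    if G: "open G" "G \<subseteq> - D" for G
  proof -
    obtain c :: "nat \<Rightarrow> ereal ^ 'n \<Rightarrow> real" and K where
      c: "\<And>j. test_fun (c j)" "\<And>j x. 0 \<le> c j x" "\<And>j x. c j x \<le> 1"
      "\<And>x. incseq (\<lambda>j. c j x)" "\<And>x. (\<lambda>j. c j x) \<longlonglongrightarrow> indicator G x"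
      "\<And>j. closed (K j)" "\<And>j. K j \<subseteq> G" "\<And>j x. x \<notin> K j \<Longrightarrow> c j x = 0"
      using open_test_cutoffs[OF G] by blast
    note [measurable] = test_fun_measurable[OF c(1)]
    have cc: "continuous_on UNIV (c j)" for j using c(1) by (auto simp: test_fun_def)
    have l1: "(\<lambda>j. \<integral>\<^sup>+x. ennreal (c j x) \<partial>(distr N borel (escale s))) \<longlonglongrightarrow> emeasure (distr N borel (escale s)) G"
      by (intro nn_integral_open_cutoffs_tendsto G cc c) auto
    have l2: "(\<lambda>j. \<integral>\<^sup>+x. ennreal (c j x) \<partial>(scale_measure (ennreal (s powr \<alpha>)) N)) \<longlonglongrightarrow> emeasure (scale_measure (ennreal (s powr \<alpha>)) N) G"
      by (intro nn_integral_open_cutoffs_tendsto G cc c) auto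
    have "(\<integral>\<^sup>+x. ennreal (c j x) \<partial>(distr N borel (escale s))) = (\<integral>\<^sup>+x. ennreal (c j x) \<partial>(scale_measure (ennreal (s powr \<alpha>)) N))" for j
    proof -
      have "(\<integral>\<^sup>+x. ennreal (c j x) \<partial>(distr N borel (escale s))) = (\<integral>\<^sup>+x. ennreal (c j (escale s x)) \<partial>N)"
        by (simp add: nn_integral_distr)
      also have "\<dots> = ennreal (\<integral>x. c j (escale s x) \<partial>N)"
        by (intro nn_integral_eq_integral test_fun_integrable test_fun_escale c s) (auto simp: c)
      also have "\<dots> = ennreal (s powr \<alpha>) * ennreal (\<integral>x. c j x \<partial>N)"
        by (simp add: integral_escale c s ennreal_mult')
      also have "ennreal (\<integral>x. c j x \<partial>N) = (\<integral>\<^sup>+x. ennreal (c j x) \<partial>N)"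
        by (intro nn_integral_eq_integral[symmetric] test_fun_integrable c) (auto simp: c)
      finally show ?thesis by (simp add: nn_integral_scale_measure)
    qed
    with l1 l2 show ?thesis by (simp add: LIMSEQ_unique)
  qed
qed simp_all

lemma nn_integral_escale:
  assumes "s > 0" "g \<in> borel_measurable borel"
  shows "(\<integral>\<^sup>+x. g (escale s x) \<partial>N) = ennreal (s powr \<alpha>) * (\<integral>\<^sup>+x. g x \<partial>N)"
proof -
  note [measurable] = assms(2) escale_measurable[OF assms(1)]
  have "(\<integral>\<^sup>+x. g (escale s x) \<partial>N) = (\<integral>\<^sup>+x. g x \<partial>(distr N borel (escale s)))"
    by (subst nn_integral_distr) measurable
  then show ?thesis by (simp add: distr_escale[OF assms(1)] nn_integral_scale_measure)
qed

end

section \<open>Tails of the functional\<close>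

lemma exp_minus_add_ge:
  fixes l d :: real
  assumes "l \<ge> 0" "d \<ge> 0"
  shows "exp (- l) - d \<le> exp (- (l + d))"
proof -
  have "exp (- l) * d \<le> 1 * d" using assms by (intro mult_right_mono) auto
  then have "exp (- l) - d \<le> exp (- l) * (1 - d)" by (simp add: algebra_simps)
  also have "\<dots> \<le> exp (- l) * exp (- d)"
    using exp_ge_add_one_self[of "- d"] by (intro mult_left_mono) auto
  finally show ?thesis by (simp add: exp_add[symmetric])
qed

text \<open>An upper bound on \<open>n * q n\<close> is enough: with \<open>b = l + e / 2\<close>
  the base is eventually at least \<open>1 - b / n\<close>, whose n-th power tends to
  \<open>exp (- b)\<close>, and passing from l to b costs at most e / 2.\<close>

lemma exp_le_power_eventually:
  fixes q :: "nat \<Rightarrow> real"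
  assumes l: "l \<ge> 0" and q: "\<And>n. q n \<le> 1" and e: "e > 0"
    and lim: "\<And>e. e > 0 \<Longrightarrow> \<forall>\<^sub>F n in sequentially. real n * q n \<le> l + e"
  shows "\<forall>\<^sub>F n in sequentially. exp (- l) - e \<le> (1 - q n) ^ n"
proof -
  define b where "b = l + e / 2"
  have "(\<lambda>n. (1 + (- b) / real n) ^ n) \<longlonglongrightarrow> exp (- b)"
    by (rule tendsto_exp_limit_sequentially)
  moreover have "exp (- l) - e < exp (- b)"
    using exp_minus_add_ge[OF l, of "e / 2"] e by (simp add: b_def)
  ultimately have ev1: "\<forall>\<^sub>F n in sequentially. exp (- l) - e < (1 + (- b) / real n) ^ n"
    by (rule order_tendstoD(1))
  have ev2: "\<forall>\<^sub>F n in sequentially. real n * q n \<le> b"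
    unfolding b_def using e by (intro lim) auto
  have "\<forall>\<^sub>F n in sequentially. b \<le> real n"
    using filterlim_real_sequentially by (simp add: filterlim_at_top)
  with ev1 ev2 eventually_gt_at_top[of 0] show ?thesis
  proof eventually_elim
    case (elim n)
    have "q n \<le> b / real n" "b / real n \<le> 1" using elim by (simp_all add: field_simps)
    then have "(1 + (- b) / real n) ^ n \<le> (1 - q n) ^ n"
      by (intro power_mono) auto
    with elim show ?case by linarith
  qed
qed

text \<open>Monotonicity in \<open>v\<close> turns the pointwise bounds on a grid of mesh \<open>\<epsilon> / (2 c)\<close> into a
  uniform one.\<close>

lemma uniform_exp_le_power_eventually:
  fixes q :: "nat \<Rightarrow> real \<Rightarrow> real"
  assumes c: "c > 0" and q1: "\<And>n v. q n v \<le> 1"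
    and mono: "\<And>n v v'. 0 < v \<Longrightarrow> v \<le> v' \<Longrightarrow> q n v \<le> q n v'"
    and lim: "\<And>v e. v > 0 \<Longrightarrow> e > 0 \<Longrightarrow> \<forall>\<^sub>F n in sequentially. real n * q n v \<le> c * v + e"
    and \<epsilon>: "\<epsilon> > 0"
  shows "\<forall>\<^sub>F n in sequentially. \<forall>v>0. exp (- c * v) - \<epsilon> \<le> (1 - q n v) ^ n"
proof -
  define \<eta> where "\<eta> = \<epsilon> / (2 * c)"
  have \<eta>: "\<eta> > 0" "c * \<eta> = \<epsilon> / 2" using \<epsilon> c by (auto simp: \<eta>_def)
  have "((\<lambda>x. exp (- c * (real x * \<eta>))) \<longlongrightarrow> 0) sequentially"
  proof -
    have "filterlim (\<lambda>x. c * \<eta> * real x) at_top sequentially"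
      using c \<eta> by (intro filterlim_tendsto_pos_mult_at_top[OF tendsto_const] filterlim_real_sequentially) auto
    then have "filterlim (\<lambda>x. - (c * \<eta> * real x)) at_bot sequentially"
      by (simp add: filterlim_uminus_at_top)
    from filterlim_compose[OF exp_at_bot this] show ?thesis by (simp add: mult_ac)
  qed
  \<comment> \<open>Beyond \<open>m * \<eta>\<close> the claimed lower bound is negative, so a
    finite grid is enough.\<close>
  from order_tendstoD(2)[OF this \<epsilon>] obtain m :: nat where m: "exp (- c * (real m * \<eta>)) < \<epsilon>"
    by (auto simp: eventually_sequentially)
  have "\<forall>\<^sub>F n in sequentially. \<forall>i\<in>{1..m}. exp (- (c * (real i * \<eta>))) - \<epsilon> / 2 \<le> (1 - q n (real i * \<eta>)) ^ n"
    using \<eta> \<epsilon> c by (intro eventually_ball_finite ballI exp_le_power_eventually lim q1) auto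
  then show ?thesis
  proof (rule eventually_mono, intro allI impI)
    fix n v assume gr: "\<forall>i\<in>{1..m}. exp (- (c * (real i * \<eta>))) - \<epsilon> / 2 \<le> (1 - q n (real i * \<eta>)) ^ n"
      and v: "(v :: real) > 0"
    \<comment> \<open>Index of the grid point at or just above v. Monotonicity of \<open>q\<close>
      compares the powers in the right direction; one mesh changes the exponential by at most
      \<open>c * \<eta> = \<epsilon> / 2\<close>, and the other half of \<epsilon> is the error at
      the grid point.\<close>
    define i where "i = nat \<lceil>v / \<eta>\<rceil>"
    have i: "v / \<eta> \<le> real i" "real i < v / \<eta> + 1" "0 < v / \<eta>"
      unfolding i_def using v \<eta> by (auto simp: of_nat_nat) linarith+
    then have iv: "v \<le> real i * \<eta>" "real i * \<eta> < v + \<eta>"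
      using \<eta> by (simp_all add: field_simps)
    have "i \<ge> 1" using i by (cases i) auto
    show "exp (- c * v) - \<epsilon> \<le> (1 - q n v) ^ n"
    proof (cases "i \<le> m")
      case True
      have "c * (real i * \<eta>) \<le> c * (v + \<eta>)" using iv(2) c by (intro mult_left_mono) auto
      then have "exp (- (c * v + \<epsilon> / 2)) \<le> exp (- (c * (real i * \<eta>)))"
        unfolding exp_le_cancel_iff using \<eta>(2) by (simp add: algebra_simps)
      moreover have "exp (- c * v) - \<epsilon> / 2 \<le> exp (- (c * v + \<epsilon> / 2))"
        using exp_minus_add_ge[of "c * v" "\<epsilon> / 2"] c v \<epsilon> by simp
      ultimately have "exp (- c * v) - \<epsilon> / 2 \<le> exp (- (c * (real i * \<eta>)))"
        by (rule order_trans[rotated])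
      also have "\<dots> \<le> (1 - q n (real i * \<eta>)) ^ n + \<epsilon> / 2"
        using bspec[OF gr, of i] True \<open>i \<ge> 1\<close> by simp
      also have "(1 - q n (real i * \<eta>)) ^ n \<le> (1 - q n v) ^ n"
        using q1[of n] mono[OF v iv(1), of n] by (intro power_mono) auto
      finally show ?thesis by simp
    next
      case False
      then have "real m + 1 \<le> real i" by simp
      then have "(real m + 1) * \<eta> \<le> real i * \<eta>" using \<eta> by (intro mult_right_mono) auto
      then have "real m * \<eta> \<le> v" using iv by (simp add: algebra_simps)
      then have "exp (- c * v) \<le> exp (- c * (real m * \<eta>))" using c by simp
      then have "exp (- c * v) - \<epsilon> \<le> 0" using m by linarith
      also have "0 \<le> (1 - q n v) ^ n" using q1[of n v] by simp
      finally show ?thesis .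
    qed
  qed
qed

locale homogeneous_functional = regular_variation D \<nu> P X \<alpha> a \<tau>
  for D :: "(ereal ^ 'n) set" and \<nu> :: "(ereal ^ 'n) measure"
    and P :: "'a measure" and X :: "'a \<Rightarrow> real ^ 'n"
    and \<alpha> :: real and a :: "nat \<Rightarrow> real" and \<tau> :: "ereal ^ 'n \<Rightarrow> ennreal" +
  fixes f :: "ereal ^ 'n \<Rightarrow> ennreal"
  assumes f_borel [measurable]: "f \<in> borel_measurable borel"
    and f_evec: "f (evec y) < \<infinity>"
    and f_0: "f 0 = 0"
    and f_hom: "c > 0 \<Longrightarrow> x \<noteq> 0 \<Longrightarrow> f (escale c x) = ennreal c * f x"
    and f_away: "\<epsilon> > 0 \<Longrightarrow> bounded_away D {x. f x > ennreal \<epsilon>}"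
    and f_INF: "compact K \<Longrightarrow> K \<subseteq> - D \<Longrightarrow> (INF x\<in>K. f x) > 0"
    and Disc_null: "emeasure \<nu> (closure (Disc f) \<inter> - D) = 0"
begin

text \<open>On \<open>range evec - D\<close> the function \<open>V\<close> is \<open>f\<^sup>-\<^sup>\<alpha>\<close>; it is scaled linearly by \<open>u \<mapsto> escale (u\<^sup>-\<^sup>1\<^sup>/\<^sup>\<alpha>)\<close>.
  Elsewhere (\<open>f = 0\<close> or \<open>f = \<infinity>\<close>) its value is the junk value 0, on an \<open>N\<close>-null set.\<close>

definition c :: real where "c = enn2real (tail_const f \<nu>)"
definition V :: "ereal ^ 'n \<Rightarrow> real" where "V x = enn2real (f x) powr (- \<alpha>)"

lemma V_measurable [measurable]: "V \<in> borel_measurable borel"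
  unfolding V_def by measurable

lemma f_escale: "s > 0 \<Longrightarrow> f (escale s x) = ennreal s * f x"
proof (cases "x = 0")
  case True
  assume "s > 0"
  have "escale s (evec (0 :: real ^ 'n)) = evec (s *\<^sub>R 0)" by (rule escale_evec)
  then have "escale s 0 = (0 :: ereal ^ 'n)" by simp
  with True show ?thesis by (simp only: f_0 mult_zero_right)
qed (simp add: f_hom)

lemma f_bounded_away:
  assumes "y > 0"
  obtains \<delta> where "\<delta> > 0" "\<And>x. f x > ennreal y \<Longrightarrow> ennreal \<delta> \<le> \<tau> x"
proof -
  obtain U where U: "open U" "D \<subseteq> U" "{x. f x > ennreal y} \<subseteq> - U"
    using f_away[OF assms] by (auto simp: bounded_away_def)
  have "compact (- U)" "- U \<subseteq> - D"
    using U by (auto intro: closed_imp_compact_ereal_vec)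
  then obtain \<delta> where "\<delta> > 0" "\<And>x. x \<in> - U \<Longrightarrow> ennreal \<delta> \<le> \<tau> x" using compact_away by metis
  with U(3) show ?thesis by (intro that[of \<delta>]) auto
qed

lemma f_ge_bounded_away:
  assumes "y > 0"
  obtains \<delta> where "\<delta> > 0" "\<And>x. ennreal y \<le> f x \<Longrightarrow> ennreal \<delta> \<le> \<tau> x"
proof -
  have "ennreal (y / 2) < ennreal y" using assms by (simp add: ennreal_less_iff)
  then show ?thesis using f_bounded_away[of "y / 2"] assms that less_le_trans
    by (metis half_gt_zero)
qed

text \<open>The two halves of condition (F) give the two directions: superlevel sets of
  \<open>f\<close> stay away from \<open>D\<close>, which forces \<open>f\<close> to vanish there,
  and the infimum over a single point outside \<open>D\<close> is positive.\<close>

lemma f_eq_0_iff: "f x = 0 \<longleftrightarrow> x \<in> D"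
proof
  assume D: "x \<in> D"
  show "f x = 0"
  proof (rule ccontr)
    assume "f x \<noteq> 0"
    then obtain y where "y > 0" "ennreal y < f x"
      using ennreal_dense_zero[of "f x"] by (auto simp: zero_less_iff_neq_zero)
    then obtain \<delta> where "\<delta> > 0" "ennreal \<delta> \<le> \<tau> x" using f_bounded_away by metis
    moreover have "\<tau> x = 0" using D by (simp add: tau_eq_0)
    ultimately show False by simp
  qed
next
  assume "f x = 0"
  then show "x \<in> D" using f_INF[of "{x}"] by auto
qed

lemma proper_f:
  assumes "x \<in> range evec - D"
  shows "f x = ennreal (enn2real (f x))" "enn2real (f x) > 0"
  using assms f_evec f_eq_0_iff[of x]
  by (auto simp: enn2real_positive_iff less_top[symmetric] zero_less_iff_neq_zero)

text \<open>A negative power reverses the order. Properness matters: where \<open>f x = 0\<close>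
  the default \<open>V x = 0\<close> satisfies the left side but not the right.\<close>

lemma V_le_iff:
  assumes "x \<in> range evec - D" "v > 0"
  shows "V x \<le> v \<longleftrightarrow> ennreal (v powr (- 1 / \<alpha>)) \<le> f x"
proof -
  have "ennreal (v powr (- 1 / \<alpha>)) \<le> f x \<longleftrightarrow> v powr (- 1 / \<alpha>) \<le> enn2real (f x)"
    using proper_f[OF assms(1)] by (metis ennreal_le_iff enn2real_nonneg)
  also have "\<dots> \<longleftrightarrow> enn2real (f x) powr (- \<alpha>) \<le> (v powr (- 1 / \<alpha>)) powr (- \<alpha>)"
    using proper_f(2)[OF assms(1)] alpha_pos assms(2)
    by (smt (verit) powr_gt_zero powr_less_mono2_neg)
  also have "(v powr (- 1 / \<alpha>)) powr (- \<alpha>) = v"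
    unfolding powr_powr using alpha_pos assms by simp
  finally show ?thesis by (simp add: V_def)
qed

lemma tail_const_N: "tail_const f \<nu> = emeasure N {x. 1 < f x}"
proof -
  have "{x. 1 < f x} - D = {x. 1 < f x}" using f_eq_0_iff by force
  then show ?thesis by (simp add: tail_const_def emeasure_N)
qed

lemma emeasure_N_ge_finite:
  assumes "y > 0"
  shows "emeasure N {x. ennreal y \<le> f x} < \<infinity>"
proof -
  obtain \<delta> where \<delta>: "\<delta> > 0" "\<And>x. ennreal y \<le> f x \<Longrightarrow> ennreal \<delta> \<le> \<tau> x"
    using f_ge_bounded_away assms by metis
  then have "emeasure N {x. ennreal y \<le> f x} \<le> emeasure N {x. ennreal \<delta> \<le> \<tau> x}"
    by (intro emeasure_mono) auto
  also have "\<dots> < \<infinity>" using \<delta> by (intro emeasure_N_away)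
  finally show ?thesis .
qed

lemma tail_const_finite: "tail_const f \<nu> < \<infinity>"
proof -
  have "emeasure N {x. 1 < f x} \<le> emeasure N {x. ennreal 1 \<le> f x}"
    by (intro emeasure_mono) auto
  then show ?thesis using emeasure_N_ge_finite[of 1] by (simp add: tail_const_N le_less_trans)
qed

lemma tail_const_c: "tail_const f \<nu> = ennreal c" "c \<ge> 0"
  using tail_const_finite by (auto simp: c_def)

section \<open>Exact tails of \<open>f\<close> and \<open>V\<close> under the limit measure\<close>

lemma emeasure_scale:
  assumes "s > 0" "A \<in> sets borel"
  shows "emeasure N (escale s -` A) = ennreal (s powr \<alpha>) * emeasure N A"
proof -
  have "emeasure (distr N borel (escale s)) A = ennreal (s powr \<alpha>) * emeasure N A"
    by (simp add: distr_escale[OF assms(1)])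
  then show ?thesis
    using assms escale_measurable[OF assms(1)] by (subst (asm) emeasure_distr) auto
qed

text \<open>By homogeneity of \<open>f\<close> the set is the preimage of
  \<open>{x. 1 < f x}\<close> under scaling by \<open>1 / y\<close>.\<close>

lemma emeasure_N_greater:
  assumes "y > 0"
  shows "emeasure N {x. ennreal y < f x} = ennreal (c * y powr - \<alpha>)"
proof -
  have "ennreal (1 / y) * f x > 1 \<longleftrightarrow> f x > ennreal y" for x
    using assms
    by (cases "f x") (auto simp: ennreal_mult'[symmetric] ennreal_1[symmetric] ennreal_less_iff
        ennreal_mult_top field_simps simp del: ennreal_1)
  then have "escale (1 / y) -` {x. 1 < f x} = {x. ennreal y < f x}"
    using assms by (auto simp: f_escale)
  then have "emeasure N {x. ennreal y < f x} = ennreal ((1 / y) powr \<alpha>) * emeasure N {x. 1 < f x}"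
    using emeasure_scale[of "1 / y" "{x. 1 < f x}"] assms by simp
  then show ?thesis
    using assms tail_const_c by (simp add: tail_const_N powr_minus_divide powr_divide ennreal_mult'[symmetric] mult.commute)
qed

text \<open>Level sets of \<open>f\<close> are null: for s < 1 the set lies in
  \<open>{x. ennreal (s * y) < f x}\<close>, and the tail just computed is continuous in the
  level.\<close>

lemma emeasure_N_ge:
  assumes "y > 0"
  shows "emeasure N {x. ennreal y \<le> f x} = ennreal (c * y powr - \<alpha>)"
proof (rule antisym)
  have "emeasure N {x. ennreal y \<le> f x} \<le> ennreal (c * (s * y) powr - \<alpha>)" if "0 < s" "s < 1" for s
  proof -
    have "ennreal (s * y) < ennreal y" using that assms by (simp add: ennreal_less_iff)
    then have "emeasure N {x. ennreal y \<le> f x} \<le> emeasure N {x. ennreal (s * y) < f x}"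
      by (intro emeasure_mono) auto
    then show ?thesis using that assms by (simp add: emeasure_N_greater)
  qed
  moreover have "((\<lambda>s. ennreal (c * (s * y) powr - \<alpha>)) \<longlongrightarrow> ennreal (c * (1 * y) powr - \<alpha>)) (at_left 1)"
    using assms by (intro tendsto_ennrealI tendsto_intros) auto
  ultimately show "emeasure N {x. ennreal y \<le> f x} \<le> ennreal (c * y powr - \<alpha>)"
    by (intro tendsto_lowerbound[where F = "at_left (1::real)"])
      (auto intro!: eventually_at_leftI[of 0])
  show "ennreal (c * y powr - \<alpha>) \<le> emeasure N {x. ennreal y \<le> f x}"
    unfolding emeasure_N_greater[OF assms, symmetric] by (intro emeasure_mono) auto
qed

text \<open>The level \<open>v powr (- 1 / \<alpha>)\<close> of \<open>f\<close> cancels the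
  exponent of the tail. The linear growth means that \<open>V\<close> carries \<open>N\<close> to c
  times Lebesgue measure on the positive half-line, which is why the limit law has mass 1.\<close>

lemma emeasure_N_V_le:
  assumes "v > 0"
  shows "emeasure N {x. V x \<le> v} = ennreal (c * v)"
proof -
  have "emeasure N {x. V x \<le> v} = emeasure N {x. ennreal (v powr (- 1 / \<alpha>)) \<le> f x}"
    by (intro emeasure_eq_AE eventually_mono[OF AE_N_proper]) (simp_all only: V_le_iff[OF _ assms] mem_Collect_eq, measurable)
  also have "\<dots> = ennreal (c * (v powr (- 1 / \<alpha>)) powr - \<alpha>)"
    using assms by (intro emeasure_N_ge) auto
  also have "(v powr (- 1 / \<alpha>)) powr - \<alpha> = v"
    unfolding powr_powr using alpha_pos assms by simp
  finally show ?thesis .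
qed

lemma UN_f_ge: "(\<Union>i. {x. ennreal (1 / Suc i) \<le> f x}) = - D"
proof (intro set_eqI iffI)
  fix x assume "x \<in> - D"
  then have "f x > 0" using f_eq_0_iff by (simp add: zero_less_iff_neq_zero)
  then obtain y where y: "ennreal y < f x" "y > 0" using ennreal_dense_zero by metis
  then obtain i where "1 / Suc i < y" using nat_approx_posE by metis
  then have "ennreal (1 / Suc i) \<le> ennreal y" by (intro ennreal_leI) auto
  with y have "ennreal (1 / Suc i) \<le> f x" by (meson less_imp_le order_trans)
  then show "x \<in> (\<Union>i. {x. ennreal (1 / Suc i) \<le> f x})" by blast
next
  fix x assume "x \<in> (\<Union>i. {x. ennreal (1 / Suc i) \<le> f x})"
  then obtain i where "ennreal (1 / Suc i) \<le> f x" by blast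
  then have "f x \<noteq> 0" by (auto simp: ennreal_eq_0_iff)
  then show "x \<in> - D" by (simp add: f_eq_0_iff)
qed

text \<open>If c vanished, all superlevel sets of \<open>f\<close> at positive levels would be null,
  and so would their union \<open>- D\<close>, against the non-triviality of \<nu>. Positivity
  enters the mesh of the grid and the exponential integrals.\<close>

lemma c_pos: "c > 0"
proof (rule ccontr)
  assume "\<not> c > 0"
  then have c0: "c = 0" using tail_const_c by simp
  have "emeasure N (\<Union>i. {x. ennreal (1 / Suc i) \<le> f x}) = 0"
    by (intro emeasure_UN_eq_0) (auto simp: emeasure_N_ge c0)
  also have "(\<Union>i. {x. ennreal (1 / Suc i) \<le> f x}) = - D" by (rule UN_f_ge)
  finally have "emeasure N (- D) = 0" .
  moreover have "- D - D = - D" by blast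
  then have "emeasure N (- D) = emeasure \<nu> (- D)"
    by (simp add: emeasure_N)
  ultimately show False using RV by (simp add: RV_def space_nu)
qed

text \<open>At a continuity point with \<open>f x < y\<close> the inequality persists nearby, so the
  point is not in the closure. Upper bounds from vague convergence concern closed sets; this
  controls what closing a superlevel set adds.\<close>

lemma closure_f_ge: "closure {x. y \<le> f x} \<subseteq> {x. y \<le> f x} \<union> closure (Disc f)"
proof
  fix x assume x: "x \<in> closure {x. y \<le> f x}"
  have "x \<in> Disc f" if "f x < y"
  proof (rule ccontr)
    assume "x \<notin> Disc f"
    then have "(f \<longlongrightarrow> f x) (at x)" by (simp add: Disc_def)
    from order_tendstoD(2)[OF this that] obtain S
      where S: "open S" "x \<in> S" "\<And>z. z \<in> S \<Longrightarrow> z \<noteq> x \<Longrightarrow> f z < y"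
      by (auto simp: eventually_at_topological)
    then have "{x. y \<le> f x} \<subseteq> - S" using that by (auto simp: not_less[symmetric])
    then have "closure {x. y \<le> f x} \<subseteq> - S" using S by (intro closure_minimal) auto
    then show False using x S by auto
  qed
  then show "x \<in> {x. y \<le> f x} \<union> closure (Disc f)"
    using closure_subset[of "Disc f"] not_le by blast
qed

text \<open>Half of the portmanteau theorem, for measures of growing mass: the test functions
  \<open>\<psi> j\<close> lie above the indicator of \<open>K\<close> and decrease to it, and the
  bump \<phi> is an integrable majorant.\<close>

lemma closed_limsup:
  assumes K: "closed K" and \<delta>: "\<delta> > 0" "\<And>x. x \<in> K \<Longrightarrow> ennreal \<delta> \<le> \<tau> x" and e: "e > 0"
  shows "\<forall>\<^sub>F n in sequentially. real n * P.prob {\<omega> \<in> space P. scaled n \<omega> \<in> K} \<le> measure N K + e"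
proof -
  obtain \<phi> where \<phi>: "test_fun \<phi>" "\<And>x. 0 \<le> \<phi> x" "\<And>x. ennreal \<delta> \<le> \<tau> x \<Longrightarrow> \<phi> x = 1"
    using bump[OF \<delta>(1)] by auto
  obtain g :: "nat \<Rightarrow> ereal ^ 'n \<Rightarrow> real" and L where
    g: "\<And>j. continuous_on UNIV (g j)" "\<And>j x. 0 \<le> g j x" "\<And>j x. g j x \<le> 1"
    "\<And>x. incseq (\<lambda>j. g j x)" "\<And>x. (\<lambda>j. g j x) \<longlonglongrightarrow> indicator (- K) x"
    "\<And>j. closed (L j)" "\<And>j. L j \<subseteq> - K" "\<And>j x. x \<notin> L j \<Longrightarrow> g j x = 0"
    using open_cutoffs_ereal_vec[of "- K"] K by auto
  define \<psi> where "\<psi> j x = \<phi> x * (1 - g j x)" for j x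
  have \<psi>: "test_fun (\<psi> j)" for j
    using \<phi>(1) g(1) unfolding test_fun_def \<psi>_def by (auto intro!: continuous_intros)
  have [measurable]: "K \<in> sets borel" using K by simp
  note [measurable] = test_fun_measurable[OF \<psi>] test_fun_measurable[OF \<phi>(1)]
  have lim: "(\<lambda>j. \<integral>x. \<psi> j x \<partial>N) \<longlonglongrightarrow> (\<integral>x. indicator K x \<partial>N)"
  proof (rule integral_dominated_convergence[where w = \<phi>])
    show "integrable N \<phi>" by (intro test_fun_integrable \<phi>)
    show "AE x in N. (\<lambda>j. \<psi> j x) \<longlonglongrightarrow> indicator K x"
    proof (rule AE_I2)
      fix x
      have "(\<lambda>j. \<psi> j x) \<longlonglongrightarrow> \<phi> x * (1 - indicator (- K) x)"
        unfolding \<psi>_def by (intro tendsto_intros g)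
      also have "\<phi> x * (1 - indicator (- K) x) = indicator K x"
        using \<delta>(2)[of x] \<phi>(3)[of x] by (auto simp: indicator_def)
      finally show "(\<lambda>j. \<psi> j x) \<longlonglongrightarrow> indicator K x" .
    qed
    show "AE x in N. norm (\<psi> j x) \<le> \<phi> x" for j
      using g(2,3)[of j] \<phi>(2) by (auto simp: \<psi>_def abs_mult mult_left_le)
  qed auto
  have "(\<integral>x. indicator K x \<partial>N) = measure N K" by simp
  with lim e have "\<forall>\<^sub>F j in sequentially. (\<integral>x. \<psi> j x \<partial>N) < measure N K + e"
    by (intro order_tendstoD(2)) auto
  then obtain j where j: "(\<integral>x. \<psi> j x \<partial>N) < measure N K + e"
    by (auto simp: eventually_sequentially)
  have "\<forall>\<^sub>F n in sequentially. real n * (\<integral>\<omega>. \<psi> j (scaled n \<omega>) \<partial>P) < measure N K + e"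
    by (intro order_tendstoD(2)[OF vague[OF \<psi>] j])
  then show ?thesis
  proof eventually_elim
    case (elim n)
    have "indicator K x \<le> \<psi> j x" for x
      using \<delta>(2)[of x] \<phi>(2,3)[of x] g(2,3)[of j x] g(7)[of j] g(8)[of x j] by (auto simp: \<psi>_def indicator_def)
    moreover have "integrable P (\<lambda>\<omega>. \<psi> j (scaled n \<omega>))"
      using \<psi>[of j] by (intro continuous_P_integrable) (auto simp: test_fun_def)
    ultimately have "(\<integral>\<omega>. indicator K (scaled n \<omega>) \<partial>P) \<le> (\<integral>\<omega>. \<psi> j (scaled n \<omega>) \<partial>P)"
      by (intro integral_mono) (auto intro!: P.integrable_const_bound[of _ 1])
    also have "(\<integral>\<omega>. indicator K (scaled n \<omega>) \<partial>P) = (\<integral>\<omega>. indicator {\<omega> \<in> space P. scaled n \<omega> \<in> K} \<omega> \<partial>P)"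
      by (intro Bochner_Integration.integral_cong) (auto simp: indicator_def)
    also have "\<dots> = P.prob {\<omega> \<in> space P. scaled n \<omega> \<in> K}" by (simp add: Int_absorb1)
    finally have "real n * P.prob {\<omega> \<in> space P. scaled n \<omega> \<in> K} \<le> real n * (\<integral>\<omega>. \<psi> j (scaled n \<omega>) \<partial>P)"
      by (intro mult_left_mono) auto
    with elim show ?case by linarith
  qed
qed

text \<open>The closure of the superlevel set stays in a region of radius at least \<delta>, and
  outside the superlevel set it meets only the null closure of \<open>Disc f\<close>. Its mass is
  therefore still at most the exact tail.\<close>

lemma tail_limsup:
  assumes y: "y > 0" and e: "e > 0"
  shows "\<forall>\<^sub>F n in sequentially. real n * P.prob {\<omega> \<in> space P. ennreal y \<le> f (scaled n \<omega>)} \<le> c * y powr - \<alpha> + e"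
proof -
  define K where "K = closure {x. ennreal y \<le> f x}"
  obtain \<delta> where \<delta>: "\<delta> > 0" "\<And>x. ennreal y \<le> f x \<Longrightarrow> ennreal \<delta> \<le> \<tau> x"
    using f_ge_bounded_away[OF y] by auto
  then have "K \<subseteq> {x. ennreal \<delta> \<le> \<tau> x}"
    unfolding K_def by (intro closure_minimal closed_Collect_le tau_cont continuous_intros) auto
  then have K: "closed K" "\<And>x. x \<in> K \<Longrightarrow> ennreal \<delta> \<le> \<tau> x" by (auto simp: K_def)
  have KD: "K \<subseteq> - D" using K(2) \<delta>(1) tau_eq_0 by force
  have cl: "closure (Disc f) \<in> sets borel" by simp
  have "emeasure N K \<le> emeasure N ({x. ennreal y \<le> f x} \<union> (closure (Disc f) \<inter> - D))"
    using closure_f_ge KD cl by (intro emeasure_mono) (auto simp: K_def intro!: sets.Un sets.Int)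
  also have "\<dots> \<le> emeasure N {x. ennreal y \<le> f x} + emeasure N (closure (Disc f) \<inter> - D)"
    using cl by (intro emeasure_subadditive) auto
  also have "emeasure N (closure (Disc f) \<inter> - D) = 0"
    using Disc_null cl by (subst emeasure_N) (auto simp: Diff_eq Int_assoc)
  finally have "emeasure N K \<le> ennreal (c * y powr - \<alpha>)" by (simp add: emeasure_N_ge y)
  then have "measure N K \<le> c * y powr - \<alpha>"
    using tail_const_c(2) unfolding measure_def by (intro enn2real_leI) auto
  moreover have "\<forall>\<^sub>F n in sequentially. real n * P.prob {\<omega> \<in> space P. scaled n \<omega> \<in> K} \<le> measure N K + e"
    by (intro closed_limsup[of _ \<delta>] K \<delta> e)
  ultimately show ?thesis
  proof (elim eventually_mono)
    fix n assume *: "measure N K \<le> c * y powr - \<alpha>" "real n * P.prob {\<omega> \<in> space P. scaled n \<omega> \<in> K} \<le> measure N K + e"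
    have "P.prob {\<omega> \<in> space P. ennreal y \<le> f (scaled n \<omega>)} \<le> P.prob {\<omega> \<in> space P. scaled n \<omega> \<in> K}"
      using borel_closed[OF K(1)] closure_subset[of "{x. ennreal y \<le> f x}"]
      by (intro P.finite_measure_mono) (auto simp: K_def[symmetric])
    then have "real n * P.prob {\<omega> \<in> space P. ennreal y \<le> f (scaled n \<omega>)} \<le> real n * P.prob {\<omega> \<in> space P. scaled n \<omega> \<in> K}"
      by (intro mult_left_mono) auto
    with * show "real n * P.prob {\<omega> \<in> space P. ennreal y \<le> f (scaled n \<omega>)} \<le> c * y powr - \<alpha> + e" by linarith
  qed
qed

lemma uniform_lower_bound:
  assumes "\<epsilon> > 0"
  shows "\<forall>\<^sub>F n in sequentially. \<forall>x. x \<notin> D \<longrightarrow> f x < \<infinity> \<longrightarrow>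
    exp (- c * V x) - \<epsilon> \<le> P.prob {\<omega> \<in> space P. f (scaled n \<omega>) < f x} ^ n"
proof -
  \<comment> \<open>Indexing levels by \<open>v = y powr (- \<alpha>)\<close> makes the limiting
    tail \<open>c * v\<close> linear and \<open>q\<close> increasing in v, as the grid argument
    requires; at \<open>v = V x\<close> the level is \<open>f x\<close>.\<close>
  define q where "q n v = P.prob {\<omega> \<in> space P. ennreal (v powr (- 1 / \<alpha>)) \<le> f (scaled n \<omega>)}" for n v
  have "\<forall>\<^sub>F n in sequentially. \<forall>v>0. exp (- c * v) - \<epsilon> \<le> (1 - q n v) ^ n"
  proof (rule uniform_exp_le_power_eventually[OF c_pos _ _ _ assms])
    show "q n v \<le> 1" for n v by (simp add: q_def)
    show "q n v \<le> q n v'" if "0 < v" "v \<le> v'" for n v v'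
    proof -
      have "v' powr (- 1 / \<alpha>) \<le> v powr (- 1 / \<alpha>)"
        using that alpha_pos by (intro powr_mono2') auto
      then show ?thesis
        unfolding q_def by (intro P.finite_measure_mono) (auto intro: order_trans ennreal_leI)
    qed
    show "\<forall>\<^sub>F n in sequentially. real n * q n v \<le> c * v + e" if "v > 0" "e > 0" for v e
    proof -
      have "(v powr (- 1 / \<alpha>)) powr - \<alpha> = v"
        unfolding powr_powr using alpha_pos that by simp
      then show ?thesis using tail_limsup[of "v powr (- 1 / \<alpha>)" e] that by (simp add: q_def)
    qed
  qed
  then show ?thesis
  proof (rule eventually_mono, intro allI impI)
    fix n x assume q: "\<forall>v>0. exp (- c * v) - \<epsilon> \<le> (1 - q n v) ^ n" and x: "x \<notin> D" "f x < \<infinity>"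
    then have F: "enn2real (f x) > 0" "f x = ennreal (enn2real (f x))"
      using f_eq_0_iff[of x] by (auto simp: enn2real_positive_iff zero_less_iff_neq_zero)
    have "V x powr (- 1 / \<alpha>) = enn2real (f x)"
      unfolding V_def powr_powr using alpha_pos F by simp
    then have "q n (V x) = P.prob {\<omega> \<in> space P. f x \<le> f (scaled n \<omega>)}"
      using F(2) by (simp add: q_def)
    moreover have "P.prob {\<omega> \<in> space P. \<not> f x \<le> f (scaled n \<omega>)} = 1 - P.prob {\<omega> \<in> space P. f x \<le> f (scaled n \<omega>)}"
      by (intro P.prob_neg) auto
    moreover have "V x > 0" using F by (simp add: V_def)
    ultimately show "exp (- c * V x) - \<epsilon> \<le> P.prob {\<omega> \<in> space P. f (scaled n \<omega>) < f x} ^ n"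
      using q by (auto simp: not_le)
  qed
qed

end

section \<open>The spectral formula and the limit law\<close>

lemma nn_integral_inverse_square_tail:
  fixes w :: real
  assumes w: "w > 0"
  shows "(\<integral>\<^sup>+u. ennreal (w / u\<^sup>2) * indicator {w<..} u \<partial>lborel) = 1"
proof -
  have "(\<integral>\<^sup>+u. ennreal (w / u\<^sup>2) * indicator {w..} u \<partial>lborel) = ennreal (0 - (- w / w))"
  proof (rule nn_integral_FTC_atLeast[where F = "\<lambda>u. - w / u"])
    show "((\<lambda>u. - w / u) has_real_derivative w / u\<^sup>2) (at u)" if "w \<le> u" for u
      using w that by (auto intro!: derivative_eq_intros simp: power2_eq_square)
    show "((\<lambda>u. - w / u) \<longlongrightarrow> 0) at_top"
      by (intro tendsto_divide_0[OF tendsto_const] filterlim_at_top_imp_at_infinity filterlim_ident)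
  qed (use w in auto)
  also have "(\<integral>\<^sup>+u. ennreal (w / u\<^sup>2) * indicator {w..} u \<partial>lborel)
      = (\<integral>\<^sup>+u. ennreal (w / u\<^sup>2) * indicator {w<..} u \<partial>lborel)"
    using AE_lborel_singleton[of w]
    by (intro nn_integral_cong_AE) (auto simp: indicator_def elim!: eventually_mono)
  finally show ?thesis using w by simp
qed

lemma nn_integral_exp_tail:
  fixes v :: real
  assumes c: "c > 0"
  shows "(\<integral>\<^sup>+t. ennreal (c * exp (- c * t)) * indicator {v..} t \<partial>lborel) = ennreal (exp (- c * v))"
proof -
  have "(\<integral>\<^sup>+t. ennreal (c * exp (- c * t)) * indicator {v..} t \<partial>lborel) = ennreal (0 - (- exp (- c * v)))"
  proof (rule nn_integral_FTC_atLeast[where F = "\<lambda>t. - exp (- c * t)"])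
    show "((\<lambda>t. - exp (- c * t)) has_real_derivative c * exp (- c * t)) (at t)" for t
      by (auto intro!: derivative_eq_intros)
    have "filterlim (\<lambda>t. - (c * t)) at_bot at_top"
      using c by (simp add: filterlim_uminus_at_top[symmetric] filterlim_tendsto_pos_mult_at_top[OF tendsto_const _ filterlim_ident])
    from tendsto_minus[OF filterlim_compose[OF exp_at_bot this]]
    show "((\<lambda>t. - exp (- c * t)) \<longlongrightarrow> 0) at_top" by simp
  qed (use c in auto)
  then show ?thesis by simp
qed

context homogeneous_functional
begin

text \<open>The analogue of \<open>V\<close> for the polar radius. At proper points
  \<open>W x / V x\<close> is the value of \<open>f\<close> at the polar angle raised to \<alpha>,
  and radius above 1 becomes \<open>W x < 1\<close>.\<close>

definition W :: "ereal ^ 'n \<Rightarrow> real" where "W x = enn2real (\<tau> x) powr (- \<alpha>)"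

lemma W_measurable [measurable]: "W \<in> borel_measurable borel"
  unfolding W_def by measurable

lemma proper_tau:
  assumes "x \<in> range evec - D"
  shows "\<tau> x = ennreal (enn2real (\<tau> x))" "enn2real (\<tau> x) > 0"
  using assms tau_evec tau_eq_0[of x]
  by (auto simp: enn2real_positive_iff less_top[symmetric] zero_less_iff_neq_zero)

lemma proper_VW:
  assumes "x \<in> range evec - D"
  shows "V x > 0" "W x > 0" "W x < 1 \<longleftrightarrow> 1 < \<tau> x" "V x < 1 \<longleftrightarrow> 1 < f x"
proof -
  have *: "r powr (- \<alpha>) < 1 \<longleftrightarrow> 1 < ennreal r" if "r > 0" for r
  proof -
    have "r powr (- \<alpha>) < 1 \<longleftrightarrow> 1 < r"
      using powr_less_mono2_neg[of "- \<alpha>" 1 r] powr_mono2'[of "- \<alpha>" r 1] alpha_pos that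
      by (cases "1 < r") simp_all
    also have "\<dots> \<longleftrightarrow> ennreal 1 < ennreal r" using that by (intro ennreal_less_iff[symmetric]) auto
    finally show ?thesis by simp
  qed
  show "V x > 0" "W x > 0"
    using proper_f(2)[OF assms] proper_tau(2)[OF assms] by (simp_all add: V_def W_def)
  show "W x < 1 \<longleftrightarrow> 1 < \<tau> x"
    using *[OF proper_tau(2)[OF assms]] unfolding proper_tau(1)[OF assms, symmetric] by (simp add: W_def)
  show "V x < 1 \<longleftrightarrow> 1 < f x"
    using *[OF proper_f(2)[OF assms]] unfolding proper_f(1)[OF assms, symmetric] by (simp add: V_def)
qed

lemma VW_escale:
  assumes "u > 0"
  shows "V (escale (u powr (- 1 / \<alpha>)) x) = u * V x" "W (escale (u powr (- 1 / \<alpha>)) x) = u * W x"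
proof -
  have "(u powr (- 1 / \<alpha>)) powr (- \<alpha>) = u"
    unfolding powr_powr using alpha_pos assms by simp
  then show "V (escale (u powr (- 1 / \<alpha>)) x) = u * V x" "W (escale (u powr (- 1 / \<alpha>)) x) = u * W x"
    using assms by (simp_all add: V_def W_def f_escale tau_escale enn2real_mult powr_mult)
qed

lemma sigma_finite_N: "sigma_finite_measure N"
proof
  have "(\<Union>i. {x. ennreal (1 / Suc i) \<le> f x}) = - D"
    by (rule UN_f_ge)
  then show "\<exists>A. countable A \<and> A \<subseteq> sets N \<and> \<Union>A = space N \<and> (\<forall>a\<in>A. emeasure N a \<noteq> \<infinity>)"
    using emeasure_N_D emeasure_N_ge_finite
    by (intro exI[of _ "insert D (range (\<lambda>i :: nat. {x. ennreal (1 / Suc i) \<le> f x}))"]) (auto simp: less_top[symmetric])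
qed

lemma Fubini_N:
  fixes g :: "ereal ^ 'n \<Rightarrow> real \<Rightarrow> ennreal"
  assumes "(\<lambda>(x, u). g x u) \<in> borel_measurable (borel \<Otimes>\<^sub>M borel)"
  shows "(\<integral>\<^sup>+x. (\<integral>\<^sup>+u. g x u \<partial>lborel) \<partial>N) = (\<integral>\<^sup>+u. (\<integral>\<^sup>+x. g x u \<partial>N) \<partial>lborel)"
proof -
  interpret N: sigma_finite_measure N by (rule sigma_finite_N)
  interpret pair_sigma_finite N lborel ..
  have eq: "sets (N \<Otimes>\<^sub>M (lborel :: real measure)) = sets (borel \<Otimes>\<^sub>M borel)"
    by (intro sets_pair_measure_cong) auto
  have "(\<lambda>(x, u). g x u) \<in> borel_measurable (N \<Otimes>\<^sub>M lborel)"
    using assms by (simp only: measurable_cong_sets[OF eq refl])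
  then show ?thesis by (rule Fubini'[symmetric])
qed

text \<open>\<open>W / V\<close> is the integral over u > 0 of \<open>W\<close> times the indicator
  of \<open>u * V x < 1\<close>. For fixed u, rescaling x by \<open>u powr (- 1 / \<alpha>)\<close>
  moves u from the condition on \<open>V\<close> to the condition on \<open>W\<close>; the rescaling
  of \<open>W\<close> and that of \<open>N\<close> contribute one factor 1 / u each. Integrating
  over u again leaves the integral of \<open>W x / u^2\<close> over \<open>u > W x\<close>, which is
  1.\<close>

lemma nn_integral_W_div_V:
  "(\<integral>\<^sup>+x. ennreal (W x / V x) * indicator {x. W x < 1} x \<partial>N) = emeasure N {x. V x < 1}"
proof -
  have "(\<integral>\<^sup>+x. ennreal (W x / V x) * indicator {x. W x < 1} x \<partial>N)
      = (\<integral>\<^sup>+x. (\<integral>\<^sup>+u. ennreal (W x) * indicator {x. W x < 1} x * indicator {0<..} u * indicator {t. t < 1} (u * V x) \<partial>lborel) \<partial>N)"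
  proof (intro nn_integral_cong_AE eventually_mono[OF AE_N_proper])
    fix x :: "ereal ^ 'n" assume x: "x \<in> range evec - D"
    have "indicator {0<..} u * indicator {t. t < 1} (u * V x) = (indicator {0<..<1 / V x} u :: ennreal)" for u :: real
      using proper_VW(1)[OF x] by (auto simp: indicator_def field_simps)
    then have "(\<integral>\<^sup>+u. ennreal (W x) * indicator {x. W x < 1} x * indicator {0<..} u * indicator {t. t < 1} (u * V x) \<partial>lborel)
       = ennreal (W x) * indicator {x. W x < 1} x * ennreal (1 / V x)"
      using proper_VW[OF x] by (simp add: mult.assoc nn_integral_cmult)
    then show "ennreal (W x / V x) * indicator {x. W x < 1} x =
      (\<integral>\<^sup>+u. ennreal (W x) * indicator {x. W x < 1} x * indicator {0<..} u * indicator {t. t < 1} (u * V x) \<partial>lborel)"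
      using proper_VW[OF x] by (simp add: mult_ac ennreal_mult'[symmetric] indicator_def)
  qed
  also have "\<dots> = (\<integral>\<^sup>+u. (\<integral>\<^sup>+x. ennreal (W x) * indicator {x. W x < 1} x * indicator {0<..} u * indicator {t. t < 1} (u * V x) \<partial>N) \<partial>lborel)"
    by (intro Fubini_N) measurable
  also have "\<dots> = (\<integral>\<^sup>+u. (\<integral>\<^sup>+x. ennreal (W x / u\<^sup>2) * indicator {0<..} u * indicator {t. t < u} (W x) * indicator {x. V x < 1} x \<partial>N) \<partial>lborel)"
  proof (rule nn_integral_cong)
    fix u :: real
    show "(\<integral>\<^sup>+x. ennreal (W x) * indicator {x. W x < 1} x * indicator {0<..} u * indicator {t. t < 1} (u * V x) \<partial>N)
      = (\<integral>\<^sup>+x. ennreal (W x / u\<^sup>2) * indicator {0<..} u * indicator {t. t < u} (W x) * indicator {x. V x < 1} x \<partial>N)"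
    proof (cases "u > 0")
      case True
      define s where "s = u powr (- 1 / \<alpha>)"
      have s: "s > 0" "s powr \<alpha> = 1 / u"
        using True alpha_pos by (simp_all add: s_def powr_powr powr_neg_one)
      define H where "H y = ennreal (W y / u) * indicator {t. t < u} (W y) * indicator {x. V x < 1} y" for y
      have [measurable]: "H \<in> borel_measurable borel" unfolding H_def by measurable
      have "ennreal (W x) * indicator {x. W x < 1} x * indicator {0<..} u * indicator {t. t < 1} (u * V x) = H (escale s x)" for x
        using True VW_escale[OF True, of x, folded s_def] by (simp add: H_def indicator_def)
      then have "(\<integral>\<^sup>+x. ennreal (W x) * indicator {x. W x < 1} x * indicator {0<..} u * indicator {t. t < 1} (u * V x) \<partial>N)
        = (\<integral>\<^sup>+x. H (escale s x) \<partial>N)" by simp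
      also have "\<dots> = ennreal (1 / u) * (\<integral>\<^sup>+x. H x \<partial>N)"
        using s by (subst nn_integral_escale) auto
      also have "\<dots> = (\<integral>\<^sup>+x. ennreal (1 / u) * H x \<partial>N)"
        by (intro nn_integral_cmult[symmetric]) auto
      also have "\<dots> = (\<integral>\<^sup>+x. ennreal (W x / u\<^sup>2) * indicator {0<..} u * indicator {t. t < u} (W x) * indicator {x. V x < 1} x \<partial>N)"
      proof (rule nn_integral_cong)
        fix x
        have "ennreal (1 / u) * ennreal (W x / u) = ennreal (W x / u\<^sup>2)"
          using True by (simp add: ennreal_mult'[symmetric] power2_eq_square)
        then show "ennreal (1 / u) * H x = ennreal (W x / u\<^sup>2) * indicator {0<..} u * indicator {t. t < u} (W x) * indicator {x. V x < 1} x"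
          using True by (simp add: H_def mult.assoc[symmetric])
      qed
      finally show ?thesis .
    next
      case False
      then show ?thesis by (simp add: indicator_def)
    qed
  qed
  also have "\<dots> = (\<integral>\<^sup>+x. (\<integral>\<^sup>+u. ennreal (W x / u\<^sup>2) * indicator {0<..} u * indicator {t. t < u} (W x) * indicator {x. V x < 1} x \<partial>lborel) \<partial>N)"
    by (intro Fubini_N[symmetric]) measurable
  also have "\<dots> = (\<integral>\<^sup>+x. indicator {x. V x < 1} x \<partial>N)"
  proof (intro nn_integral_cong_AE eventually_mono[OF AE_N_proper])
    fix x :: "ereal ^ 'n" assume x: "x \<in> range evec - D"
    have *: "indicator {0<..} u * indicator {t. t < u} (W x) = (indicator {W x<..} u :: ennreal)" for u :: real
      using proper_VW(2)[OF x] by (auto simp: indicator_def)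
    have "(\<integral>\<^sup>+u. ennreal (W x / u\<^sup>2) * indicator {0<..} u * indicator {t. t < u} (W x) * indicator {x. V x < 1} x \<partial>lborel)
      = (\<integral>\<^sup>+u. ennreal (W x / u\<^sup>2) * indicator {W x<..} u * indicator {x. V x < 1} x \<partial>lborel)"
      by (simp only: *[symmetric] mult.assoc)
    then show "(\<integral>\<^sup>+u. ennreal (W x / u\<^sup>2) * indicator {0<..} u * indicator {t. t < u} (W x) * indicator {x. V x < 1} x \<partial>lborel)
      = indicator {x. V x < 1} x"
      using nn_integral_inverse_square_tail[OF proper_VW(2)[OF x]]
      by (simp add: nn_integral_multc)
  qed
  finally show ?thesis by simp
qed

text \<open>\<open>spectral_measure\<close> is a \<open>distr\<close>, whose integrals are computed
  through measurability of the map. The angle is even continuous on \<open>?A\<close>, since the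
  radius is finite and nonzero there.\<close>

lemma polar_angle_measurable:
  "polar_angle \<tau> \<in> measurable (restrict_space \<nu> {x \<in> range evec - D. 1 < \<tau> x}) (restrict_space borel (polar_sphere \<tau>))"
proof (rule measurable_restrict_space2)
  let ?A = "{x \<in> range evec - D. 1 < \<tau> x}"
  have inv: "0 < 1 / enn2real (\<tau> x)" if "x \<in> ?A" for x
    using proper_tau(2)[of x] that by simp
  show "polar_angle \<tau> \<in> space (restrict_space \<nu> ?A) \<rightarrow> polar_sphere \<tau>"
  proof
    fix x assume "x \<in> space (restrict_space \<nu> ?A)"
    then have x: "x \<in> range evec - D" by (auto simp: space_restrict_space)
    define r where "r = enn2real (\<tau> x)"
    have r: "r > 0" "\<tau> x = ennreal r" using proper_tau[OF x] by (auto simp only: r_def)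
    have "\<tau> (polar_angle \<tau> x) = ennreal (1 / r) * ennreal r"
      using r by (simp add: polar_angle_def tau_escale)
    also have "\<dots> = 1" using r(1) by (simp flip: ennreal_mult')
    finally have "\<tau> (polar_angle \<tau> x) = 1" .
    moreover have "polar_angle \<tau> x \<in> range evec"
      using x by (auto simp: polar_angle_def escale_evec)
    ultimately show "polar_angle \<tau> x \<in> polar_sphere \<tau>" by (simp add: polar_sphere_def)
  qed
  have "continuous_on ?A (\<lambda>x. enn2real (\<tau> x))"
    using continuous_on_subset[OF tau_cont subset_UNIV, of ?A] unfolding continuous_on_def
    by (auto intro!: tendsto_enn2real simp: ennreal_enn2real[OF tau_evec[unfolded infinity_ennreal_def]])
  then have "continuous_on ?A (\<lambda>x. (1 / enn2real (\<tau> x), x))"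
    using inv by (intro continuous_intros) (auto simp: less_le)
  then have "continuous_on ?A (polar_angle \<tau>)"
    using continuous_on_compose2[OF continuous_on_escale, of ?A "\<lambda>x. (1 / enn2real (\<tau> x), x)"] inv
    unfolding polar_angle_def by (auto simp: image_subset_iff)
  then have "polar_angle \<tau> \<in> measurable (restrict_space borel ?A) borel"
    by (rule borel_measurable_continuous_on_restrict)
  moreover have eq: "sets (restrict_space \<nu> ?A) = sets (restrict_space borel ?A)"
  proof -
    have "sets (restrict_space \<nu> ?A) = sets (restrict_space (restrict_space borel (- D)) ?A)"
      using sets_nu by (rule sets_restrict_space_cong)
    also have "\<dots> = sets (restrict_space borel (- D \<inter> ?A))" by (rule sets_restrict_restrict_space)
    also have "- D \<inter> ?A = ?A" by auto
    finally show ?thesis .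
  qed
  ultimately show "polar_angle \<tau> \<in> measurable (restrict_space \<nu> ?A) borel"
    by (simp only: measurable_cong_sets[OF eq refl])
qed

text \<open>Pulled back along the angle, the integrand is \<open>W / V\<close> on the set of radius
  above 1. The orbit computation exchanges the roles of \<open>\<tau>\<close> and \<open>f\<close>
  and leaves the mass of \<open>{x. V x < 1}\<close>, which is \<open>{x. 1 < f x}\<close> up to a
  null set.\<close>

lemma tail_const_spectral:
  "tail_const f \<nu> = (\<integral>\<^sup>+ \<theta>. ennreal (enn2real (f \<theta>) powr \<alpha>) \<partial>(spectral_measure D \<tau> \<nu>))"
proof -
  let ?A = "{x \<in> range evec - D. 1 < \<tau> x}"
  have A [measurable]: "?A \<in> sets borel" by measurable
  have "(\<integral>\<^sup>+ \<theta>. ennreal (enn2real (f \<theta>) powr \<alpha>) \<partial>(spectral_measure D \<tau> \<nu>))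
    = (\<integral>\<^sup>+ x. ennreal (enn2real (f (polar_angle \<tau> x)) powr \<alpha>) \<partial>(restrict_space \<nu> ?A))"
    unfolding spectral_measure_def
    by (intro nn_integral_distr polar_angle_measurable) (simp only: measurable_distr_eq1, intro measurable_restrict_space1, measurable)
  also have "\<dots> = (\<integral>\<^sup>+ x. ennreal (enn2real (f (polar_angle \<tau> x)) powr \<alpha>) * indicator ?A x \<partial>\<nu>)"
  proof (rule nn_integral_restrict_space)
    have "?A \<inter> space \<nu> = ?A" by (auto simp: space_nu)
    moreover have "?A \<in> sets \<nu>"
      using A D_closed unfolding sets_nu by (subst sets_restrict_space_iff) auto
    ultimately show "?A \<inter> space \<nu> \<in> sets \<nu>" by simp
  qed
  also have "\<dots> = (\<integral>\<^sup>+ x. ennreal (W x / V x) * indicator ?A x \<partial>\<nu>)"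
  proof (rule nn_integral_cong)
    fix x
    have "enn2real (f (polar_angle \<tau> x)) powr \<alpha> = W x / V x" if "x \<in> ?A"
    proof -
      have x: "x \<in> range evec - D" using that by simp
      have "enn2real (f (polar_angle \<tau> x)) = enn2real (f x) / enn2real (\<tau> x)"
        using proper_tau(2)[OF x] by (simp add: polar_angle_def f_escale enn2real_mult)
      then show ?thesis
        using proper_tau(2)[OF x] proper_f(2)[OF x] by (simp add: V_def W_def powr_divide powr_minus_divide)
    qed
    then show "ennreal (enn2real (f (polar_angle \<tau> x)) powr \<alpha>) * indicator ?A x = ennreal (W x / V x) * indicator ?A x"
      by (simp add: indicator_def)
  qed
  also have "\<dots> = (\<integral>\<^sup>+ x. ennreal (W x / V x) * indicator ?A x \<partial>N)"
    by (intro nn_integral_N[symmetric]) measurable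
  also have "\<dots> = (\<integral>\<^sup>+ x. ennreal (W x / V x) * indicator {x. W x < 1} x \<partial>N)"
    by (intro nn_integral_cong_AE eventually_mono[OF AE_N_proper]) (simp add: indicator_def proper_VW(3))
  also have "\<dots> = emeasure N {x. V x < 1}" by (rule nn_integral_W_div_V)
  also have "\<dots> = emeasure N {x. 1 < f x}"
    by (intro emeasure_eq_AE eventually_mono[OF AE_N_proper]) (simp add: proper_VW(4), measurable)
  finally show ?thesis by (simp add: tail_const_N)
qed

text \<open>\<open>exp (- c * V x)\<close> is the mass beyond \<open>V x\<close> of the exponential
  density. After exchanging the integrals, the linear growth of \<open>N {x. V x \<le> t}\<close>
  turns that density into \<open>c^2 * t * exp (- c * t)\<close>, which is the Erlang density of
  shape index 1.\<close>

lemma nn_integral_exp_V: "(\<integral>\<^sup>+x. ennreal (exp (- c * V x)) \<partial>N) = 1"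
proof -
  have "(\<integral>\<^sup>+x. ennreal (exp (- c * V x)) \<partial>N)
      = (\<integral>\<^sup>+x. (\<integral>\<^sup>+t. ennreal (c * exp (- c * t)) * indicator {u. 0 \<le> u} (t - V x) \<partial>lborel) \<partial>N)"
  proof (rule nn_integral_cong)
    fix x
    have "indicator {u. 0 \<le> u} (t - V x) = (indicator {V x..} t :: ennreal)" for t
      by (auto simp: indicator_def)
    then show "ennreal (exp (- c * V x)) = (\<integral>\<^sup>+t. ennreal (c * exp (- c * t)) * indicator {u. 0 \<le> u} (t - V x) \<partial>lborel)"
      using nn_integral_exp_tail[OF c_pos, of "V x"] by simp
  qed
  also have "\<dots> = (\<integral>\<^sup>+t. (\<integral>\<^sup>+x. ennreal (c * exp (- c * t)) * indicator {u. 0 \<le> u} (t - V x) \<partial>N) \<partial>lborel)"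
    by (intro Fubini_N) measurable
  also have "\<dots> = (\<integral>\<^sup>+t. ennreal (erlang_density 1 c t) \<partial>lborel)"
  proof (rule nn_integral_cong)
    fix t :: real
    have "indicator {u. 0 \<le> u} (t - V x) = (indicator {x. V x \<le> t} x :: ennreal)" for x
      by (auto simp: indicator_def)
    then have "(\<integral>\<^sup>+x. ennreal (c * exp (- c * t)) * indicator {u. 0 \<le> u} (t - V x) \<partial>N)
      = ennreal (c * exp (- c * t)) * emeasure N {x. V x \<le> t}"
      by (simp add: nn_integral_cmult)
    also have "emeasure N {x. V x \<le> t} = (if t > 0 then ennreal (c * t) else 0)"
    proof (cases "t > 0")
      \<comment> \<open>At t = 0 the set may be nonempty, since improper points can carry the
        default \<open>V x = 0\<close>; it is null nevertheless.\<close>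
      case False
      have "AE x in N. x \<notin> {x. V x \<le> t}"
        using AE_N_proper
      proof eventually_elim
        case (elim x)
        with proper_VW(1)[OF elim] False show ?case by simp
      qed
      then have "emeasure N {x. V x \<le> t} = 0"
        by (subst (asm) AE_iff_measurable[of "{x. V x \<le> t}"]) auto
      then show ?thesis using False by simp
    qed (simp add: emeasure_N_V_le)
    also have "ennreal (c * exp (- c * t)) * (if t > 0 then ennreal (c * t) else 0) = ennreal (erlang_density 1 c t)"
      using c_pos by (auto simp: erlang_density_def ennreal_mult'[symmetric] power2_eq_square mult_ac)
    finally show "(\<integral>\<^sup>+x. ennreal (c * exp (- c * t)) * indicator {u. 0 \<le> u} (t - V x) \<partial>N)
      = ennreal (erlang_density 1 c t)" .
  qed
  also have "\<dots> = 1"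
    using nn_integral_erlang_ith_moment[OF c_pos, of 1 0] by simp
  finally show ?thesis .
qed

lemma limit_law_eq: "limit_law \<alpha> f \<nu> = density \<nu> (\<lambda>x. ennreal (exp (- c * V x)))"
  by (simp add: limit_law_def V_def c_def)

lemma prob_space_limit_law: "prob_space (limit_law \<alpha> f \<nu>)"
proof
  have m: "(\<lambda>x. ennreal (exp (- c * V x))) \<in> borel_measurable \<nu>"
    by (rule measurable_nuI) measurable
  have "emeasure (limit_law \<alpha> f \<nu>) (space \<nu>) = (\<integral>\<^sup>+x. ennreal (exp (- c * V x)) \<partial>\<nu>)"
    unfolding limit_law_eq by (subst emeasure_density[OF m]) (auto intro!: nn_integral_cong)
  also have "\<dots> = (\<integral>\<^sup>+x. ennreal (exp (- c * V x)) \<partial>N)"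
    by (intro nn_integral_N[symmetric]) measurable
  finally show "emeasure (limit_law \<alpha> f \<nu>) (space (limit_law \<alpha> f \<nu>)) = 1"
    using nn_integral_exp_V by (simp add: limit_law_eq)
qed

end

section \<open>Strict maxima of independent variables\<close>

lemma first_argmax_mem:
  assumes "n \<ge> 1"
  shows "first_argmax g n \<in> {1..n}"
proof -
  have "Max (g ` {1..n}) \<in> g ` {1..n}" using assms by (intro Max_in) auto
  then obtain k where "k \<in> {1..n} \<and> g k = Max (g ` {1..n})" by auto
  then show ?thesis unfolding first_argmax_def by (rule LeastI2) auto
qed

lemma first_argmax_unique:
  assumes k: "k \<in> {1..n}" and less: "\<And>i. i \<in> {1..n} - {k} \<Longrightarrow> g i < g k"
  shows "first_argmax g n = k"
proof -
  have *: "j \<in> {1..n} \<and> g j = Max (g ` {1..n}) \<longleftrightarrow> j = k" for j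
  proof -
    have "g i \<le> g k" if "i \<in> {1..n}" for i
      using less[of i] that by (cases "i = k") (auto intro: less_imp_le)
    then have "Max (g ` {1..n}) = g k"
      using k by (intro Max_eqI) auto
    then show ?thesis using k less[of j] by (cases "j = k") auto
  qed
  show ?thesis unfolding first_argmax_def * by (rule Least_equality) auto
qed

text \<open>Equality with \<open>Max\<close> is replaced by finitely many inequalities, so that each
  candidate index becomes a measurable predicate for \<open>measurable_Least\<close>.\<close>

lemma first_argmax_measurable:
  fixes g :: "nat \<Rightarrow> 'a \<Rightarrow> ennreal"
  assumes g: "\<And>i. i \<in> {1..n} \<Longrightarrow> g i \<in> borel_measurable M"
  shows "(\<lambda>\<omega>. first_argmax (\<lambda>i. g i \<omega>) n) \<in> measurable M (count_space UNIV)"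
proof -
  have eq: "first_argmax (\<lambda>i. g i \<omega>) n = (LEAST k. k \<in> {1..n} \<and> (\<forall>i\<in>{1..n}. g i \<omega> \<le> g k \<omega>))" for \<omega>
    unfolding first_argmax_def
  proof (intro arg_cong[where f = Least] ext conj_cong refl)
    fix k assume "k \<in> {1..n}"
    then show "g k \<omega> = Max ((\<lambda>i. g i \<omega>) ` {1..n}) \<longleftrightarrow> (\<forall>i\<in>{1..n}. g i \<omega> \<le> g k \<omega>)"
      by (subst eq_commute, subst Max_eq_iff) auto
  qed
  have m: "(\<lambda>\<omega>. k \<in> {1..n} \<and> (\<forall>i\<in>{1..n}. g i \<omega> \<le> g k \<omega>)) \<in> measurable M (count_space UNIV)" for k
  proof (cases "k \<in> {1..n}")
    case True
    have "Measurable.pred M (\<lambda>\<omega>. g i \<omega> \<le> g k \<omega>)" if "i \<in> {1..n}" for i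
    proof -
      note [measurable] = g[OF that] g[OF True]
      show ?thesis by measurable
    qed
    then show ?thesis
      using True by (intro pred_intros_logic pred_intros_finite) auto
  next
    case False
    then have "(\<lambda>\<omega>. k \<in> {1..n} \<and> (\<forall>i\<in>{1..n}. g i \<omega> \<le> g k \<omega>)) = (\<lambda>_. False)" by auto
    then show ?thesis by simp
  qed
  show ?thesis unfolding eq by (intro measurable_Least m)
qed

text \<open>\<open>Xs k\<close> is independent of the block of its competitors. Given its value x,
  the n - 1 independent copies all stay below \<open>g x\<close> with probability
  \<open>p x ^ (n - 1)\<close>, and Fubini integrates this over the law of
  \<open>Xs k\<close>.\<close>

lemma nn_integral_strict_argmax:
  fixes Xs :: "nat \<Rightarrow> 'b \<Rightarrow> 's" and g h :: "'s \<Rightarrow> ennreal"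
  assumes M: "prob_space M" and P: "prob_space P"
    and indep: "prob_space.indep_vars M (\<lambda>_. S) Xs {1..}"
    and copies: "\<And>i. i \<ge> 1 \<Longrightarrow> distr M S (Xs i) = distr P S X"
    and X [measurable]: "X \<in> measurable P S"
    and g [measurable]: "g \<in> borel_measurable S" and h [measurable]: "h \<in> borel_measurable S"
    and n: "n \<ge> 2" and k: "k \<in> {1..n}"
  shows "(\<integral>\<^sup>+\<omega>. h (Xs k \<omega>) * indicator {\<omega>. \<forall>i\<in>{1..n} - {k}. g (Xs i \<omega>) < g (Xs k \<omega>)} \<omega> \<partial>M)
    = (\<integral>\<^sup>+\<omega>. h (X \<omega>) * ennreal (measure P {\<omega>' \<in> space P. g (X \<omega>') < g (X \<omega>)} ^ (n - 1)) \<partial>P)"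
proof -
  interpret M: prob_space M by (rule M)
  interpret P: prob_space P by (rule P)
  define I where "I = {1..n} - {k}"
  have I: "finite I" "I \<noteq> {}" "card I = n - 1" "I \<subseteq> {1..}" "k \<notin> I"
  proof -
    \<comment> \<open>A competitor must exist: an intersection over no indices is
      \<open>UNIV\<close>, and \<open>indep_varsD\<close> asks for a nonempty index set.\<close>
    show "I \<noteq> {}"
    proof
      assume "I = {}"
      then have "card {1..n} \<le> card {k}" by (intro card_mono) (auto simp: I_def)
      with n show False by simp
    qed
  qed (use k in \<open>auto simp: I_def\<close>)
  have Xs [measurable]: "Xs i \<in> measurable M S" if "i \<ge> 1" for i
    using indep that by (auto simp: M.indep_vars_def)
  \<comment> \<open>Both blocks are kept as restricted functions, the form in which
    \<open>indep_var_restrict\<close> yields their independence.\<close>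
  define A where "A \<omega> = restrict (\<lambda>i. Xs i \<omega>) {k}" for \<omega>
  define R where "R \<omega> = restrict (\<lambda>i. Xs i \<omega>) I" for \<omega>
  define \<mu> where "\<mu> = distr M (PiM I (\<lambda>_. S)) R"
  define p where "p x = measure P {\<omega>' \<in> space P. g (X \<omega>') < g x}" for x
  have ind: "M.indep_var (PiM {k} (\<lambda>_. S)) A (PiM I (\<lambda>_. S)) R"
    unfolding A_def R_def using k I by (intro M.indep_var_restrict[OF indep]) auto
  have AR [measurable]: "A \<in> measurable M (PiM {k} (\<lambda>_. S))" "R \<in> measurable M (PiM I (\<lambda>_. S))"
    and prod: "distr M (PiM {k} (\<lambda>_. S)) A \<Otimes>\<^sub>M \<mu>
      = distr M (PiM {k} (\<lambda>_. S) \<Otimes>\<^sub>M PiM I (\<lambda>_. S)) (\<lambda>\<omega>. (A \<omega>, R \<omega>))"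
    using ind by (auto simp: M.indep_var_distribution_eq \<mu>_def)
  interpret \<mu>: prob_space \<mu>
    unfolding \<mu>_def by (intro M.prob_space_distr AR)
  have [measurable_cong]: "sets \<mu> = sets (PiM I (\<lambda>_. S))" by (simp add: \<mu>_def)
  define F where "F = (\<lambda>z :: 's \<times> (nat \<Rightarrow> 's). h (fst z) * indicator {z. \<forall>i\<in>I. g (snd z i) < g (fst z)} z)"
  have F_meas [measurable]: "F \<in> borel_measurable (S \<Otimes>\<^sub>M PiM I (\<lambda>_. S))"
  proof -
    have "Measurable.pred (S \<Otimes>\<^sub>M PiM I (\<lambda>_. S)) (\<lambda>z. g (snd z i) < g (fst z))" if "i \<in> I" for i
    proof -
      have [measurable]: "(\<lambda>z. snd z i) \<in> measurable (S \<Otimes>\<^sub>M PiM I (\<lambda>_. S)) S"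
        using measurable_compose[OF measurable_snd measurable_component_singleton[OF that]] .
      show ?thesis by measurable
    qed
    then have [measurable]: "Measurable.pred (S \<Otimes>\<^sub>M PiM I (\<lambda>_. S)) (\<lambda>z. \<forall>i\<in>I. g (snd z i) < g (fst z))"
      using I(1) by (intro pred_intros_finite)
    show ?thesis unfolding F_def by measurable
  qed
  have inner: "(\<integral>\<^sup>+y. F (x, y) \<partial>\<mu>) = h x * ennreal (p x ^ (n - 1))" if x: "x \<in> space S" for x
  proof -
    define B where "B = {z \<in> space S. g z < g x}"
    have B [measurable]: "B \<in> sets S" unfolding B_def by measurable
    have prB: "M.prob (Xs i -` B \<inter> space M) = p x" if "i \<in> I" for i
    proof -
      have "i \<ge> 1" using that by (simp add: I_def)
      have "M.prob (Xs i -` B \<inter> space M) = measure (distr M S (Xs i)) B"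
        using Xs[OF \<open>i \<ge> 1\<close>] by (simp add: measure_distr)
      also have "\<dots> = measure P (X -` B \<inter> space P)"
        by (simp add: copies[OF \<open>i \<ge> 1\<close>] measure_distr)
      also have "X -` B \<inter> space P = {\<omega>' \<in> space P. g (X \<omega>') < g x}"
        using measurable_space[OF X] by (auto simp: B_def)
      finally show ?thesis by (simp add: p_def)
    qed
    have "(\<integral>\<^sup>+y. F (x, y) \<partial>\<mu>) = (\<integral>\<^sup>+\<omega>. F (x, R \<omega>) \<partial>M)"
      unfolding \<mu>_def using measurable_compose[OF measurable_Pair1'[OF x] F_meas]
      by (intro nn_integral_distr) auto
    also have "\<dots> = (\<integral>\<^sup>+\<omega>. h x * indicator (\<Inter>i\<in>I. Xs i -` B \<inter> space M) \<omega> \<partial>M)"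
    proof (rule nn_integral_cong)
      fix \<omega> assume \<omega>: "\<omega> \<in> space M"
      have "Xs i \<omega> \<in> space S" if "i \<in> I" for i
        using Xs[THEN measurable_space, OF _ \<omega>] that I by auto
      then have "\<omega> \<in> (\<Inter>i\<in>I. Xs i -` B \<inter> space M) \<longleftrightarrow> (\<forall>i\<in>I. g (R \<omega> i) < g x)"
        using \<omega> I(2) unfolding INT_iff by (intro ball_cong refl) (simp add: R_def B_def)
      then show "F (x, R \<omega>) = h x * indicator (\<Inter>i\<in>I. Xs i -` B \<inter> space M) \<omega>"
        by (simp add: F_def indicator_def)
    qed
    also have "\<dots> = h x * emeasure M (\<Inter>i\<in>I. Xs i -` B \<inter> space M)"
      using I by (intro nn_integral_cmult_indicator sets.finite_INT measurable_sets[OF Xs B]) auto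
    also have "M.prob (\<Inter>i\<in>I. Xs i -` B \<inter> space M) = (\<Prod>i\<in>I. M.prob (Xs i -` B \<inter> space M))"
      using I by (intro M.indep_varsD[OF indep]) auto
    then have "emeasure M (\<Inter>i\<in>I. Xs i -` B \<inter> space M) = ennreal (p x ^ (n - 1))"
      using I by (simp add: M.emeasure_eq_measure prB)
    finally show ?thesis .
  qed
  have p_meas: "p \<in> borel_measurable S"
  proof -
    define Q where "Q = {z \<in> space (S \<Otimes>\<^sub>M P). g (X (snd z)) < g (fst z)}"
    have "Q \<in> sets (S \<Otimes>\<^sub>M P)" unfolding Q_def by measurable
    then have "(\<lambda>x. enn2real (emeasure P (Pair x -` Q))) \<in> borel_measurable S"
      by (intro borel_measurable_enn2real P.measurable_emeasure_Pair)
    moreover have "enn2real (emeasure P (Pair x -` Q)) = p x" if "x \<in> space S" for x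
    proof -
      have "Pair x -` Q = {\<omega>' \<in> space P. g (X \<omega>') < g x}"
        using that by (auto simp: Q_def space_pair_measure)
      then show ?thesis by (simp add: p_def measure_def)
    qed
    ultimately show ?thesis by (simp cong: measurable_cong)
  qed
  define G where "G x = h x * ennreal (p x ^ (n - 1))" for x
  have G_meas [measurable]: "G \<in> borel_measurable S" using p_meas unfolding G_def by measurable
  have Gk: "(\<lambda>u. G (u k)) \<in> borel_measurable (PiM {k} (\<lambda>_. S))"
    by (rule measurable_compose[OF _ G_meas]) (rule measurable_component_singleton, simp)
  have Fk: "(\<lambda>z. F (fst z k, snd z)) \<in> borel_measurable (PiM {k} (\<lambda>_. S) \<Otimes>\<^sub>M PiM I (\<lambda>_. S))"
    by (rule measurable_compose[OF _ F_meas], rule measurable_Pair)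
      (auto intro: measurable_compose[OF measurable_fst measurable_component_singleton] measurable_snd)
  have "(\<integral>\<^sup>+\<omega>. h (Xs k \<omega>) * indicator {\<omega>. \<forall>i\<in>{1..n} - {k}. g (Xs i \<omega>) < g (Xs k \<omega>)} \<omega> \<partial>M)
    = (\<integral>\<^sup>+\<omega>. F (A \<omega> k, R \<omega>) \<partial>M)"
    by (intro nn_integral_cong) (auto simp: F_def A_def R_def I_def indicator_def)
  also have "\<dots> = (\<integral>\<^sup>+z. F (fst z k, snd z) \<partial>(distr M (PiM {k} (\<lambda>_. S)) A \<Otimes>\<^sub>M \<mu>))"
    unfolding prod using Fk by (subst nn_integral_distr) auto
  also have "\<dots> = (\<integral>\<^sup>+u. (\<integral>\<^sup>+y. F (u k, y) \<partial>\<mu>) \<partial>distr M (PiM {k} (\<lambda>_. S)) A)"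
  proof -
    have "sets (distr M (PiM {k} (\<lambda>_. S)) A \<Otimes>\<^sub>M \<mu>) = sets (PiM {k} (\<lambda>_. S) \<Otimes>\<^sub>M PiM I (\<lambda>_. S))"
      by (intro sets_pair_measure_cong) (auto simp: \<mu>_def)
    from \<mu>.nn_integral_fst[OF Fk[folded measurable_cong_sets[OF this refl]]] show ?thesis by simp
  qed
  also have "\<dots> = (\<integral>\<^sup>+u. G (u k) \<partial>distr M (PiM {k} (\<lambda>_. S)) A)"
    by (intro nn_integral_cong) (simp, subst inner, auto simp: G_def space_PiM)
  also have "\<dots> = (\<integral>\<^sup>+\<omega>. G (Xs k \<omega>) \<partial>M)"
    using Gk by (subst nn_integral_distr) (auto simp: A_def)
  also have "\<dots> = (\<integral>\<^sup>+x. G x \<partial>distr M S (Xs k))"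
    using k by (intro nn_integral_distr[symmetric]) auto
  also have "distr M S (Xs k) = distr P S X" using k by (intro copies) auto
  also have "(\<integral>\<^sup>+x. G x \<partial>distr P S X) = (\<integral>\<^sup>+\<omega>. G (X \<omega>) \<partial>P)"
    by (intro nn_integral_distr) auto
  finally show ?thesis by (simp add: G_def p_def)
qed

text \<open>\<open>O'\<close> and \<open>- K\<close> are open and cover the space. This serves for a
  cutoff supported in \<open>K\<close> times \<open>exp (- c * V x)\<close>, whose continuity is
  known only on \<open>O'\<close>.\<close>

lemma continuous_on_UNIV_extend:
  fixes h :: "'a :: topological_space \<Rightarrow> real"
  assumes "continuous_on O' h" "open O'" "closed K" "K \<subseteq> O'" "\<And>x. x \<notin> K \<Longrightarrow> h x = 0"
  shows "continuous_on UNIV h"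
proof -
  have "continuous_on (- K) h"
    using continuous_on_const[of "- K" 0] assms(5) by (subst continuous_on_cong[OF refl, of _ _ "\<lambda>_. 0"]) auto
  with assms have "continuous_on (O' \<union> - K) h" by (intro continuous_on_open_Un) auto
  moreover have "O' \<union> - K = UNIV" using assms(4) by auto
  ultimately show ?thesis by simp
qed

section \<open>Convergence of the maximizing vector\<close>

locale iid_sample = homogeneous_functional D \<nu> P X \<alpha> a \<tau> f
  for D :: "(ereal ^ 'n) set" and \<nu> :: "(ereal ^ 'n) measure"
    and P :: "'a measure" and X :: "'a \<Rightarrow> real ^ 'n"
    and \<alpha> :: real and a :: "nat \<Rightarrow> real" and \<tau> :: "ereal ^ 'n \<Rightarrow> ennreal"
    and f :: "ereal ^ 'n \<Rightarrow> ennreal" +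
  fixes M :: "'b measure" and Xs :: "nat \<Rightarrow> 'b \<Rightarrow> real ^ 'n"
  assumes prob_M: "prob_space M"
    and indep: "prob_space.indep_vars M (\<lambda>_. borel) Xs {1..}"
    and copies: "i \<ge> 1 \<Longrightarrow> distr M borel (Xs i) = distr P borel X"
begin

sublocale M: prob_space M by (rule prob_M)

definition \<xi> :: "nat \<Rightarrow> nat \<Rightarrow> 'b \<Rightarrow> ereal ^ 'n" where
  "\<xi> n i \<omega> = evec ((1 / a n) *\<^sub>R Xs i \<omega>)"

definition Z :: "nat \<Rightarrow> 'b \<Rightarrow> ereal ^ 'n" where
  "Z n \<omega> = \<xi> n (first_argmax (\<lambda>i. f (evec (Xs i \<omega>))) n) \<omega>"

lemma Xs_measurable [measurable]: "i \<ge> 1 \<Longrightarrow> Xs i \<in> borel_measurable M"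
  using indep by (auto simp: M.indep_vars_def)

lemma \<xi>_measurable [measurable]: "i \<ge> 1 \<Longrightarrow> \<xi> n i \<in> measurable M borel"
  unfolding \<xi>_def by measurable

lemma Z_measurable [measurable]:
  assumes "n \<ge> 1"
  shows "Z n \<in> measurable M borel"
  unfolding Z_def
proof (rule measurable_compose_countable'[where I = "{1..n}"])
  have "(\<lambda>\<omega>. first_argmax (\<lambda>i. f (evec (Xs i \<omega>))) n) \<in> measurable M (count_space UNIV)"
    by (intro first_argmax_measurable) auto
  from measurable_sets[OF this] show "(\<lambda>\<omega>. first_argmax (\<lambda>i. f (evec (Xs i \<omega>))) n) \<in> measurable M (count_space {1..n})"
    using first_argmax_mem[OF assms] by (subst measurable_count_space_eq2) (simp_all only: Pi_iff finite_atLeastAtMost, auto)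
qed auto

lemma f_evec_scale: "n \<ge> 1 \<Longrightarrow> f (evec ((1 / a n) *\<^sub>R x)) = ennreal (1 / a n) * f (evec x)"
  using a_pos[of n] by (simp add: escale_evec[symmetric] f_escale)

text \<open>\<open>Z\<close> takes its index from the unscaled vectors, but by homogeneity scaling
  multiplies all values of \<open>f\<close> by the same factor \<open>1 / a n\<close>, so their
  order is unaffected.\<close>

lemma Z_strict_max:
  assumes n: "n \<ge> 1" and k: "k \<in> {1..n}" and less: "\<And>i. i \<in> {1..n} - {k} \<Longrightarrow> f (\<xi> n i \<omega>) < f (\<xi> n k \<omega>)"
  shows "Z n \<omega> = \<xi> n k \<omega>"
proof -
  have "f (evec (Xs i \<omega>)) < f (evec (Xs k \<omega>))" if "i \<in> {1..n} - {k}" for i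
  proof (rule ccontr)
    assume "\<not> f (evec (Xs i \<omega>)) < f (evec (Xs k \<omega>))"
    then have "f (\<xi> n k \<omega>) \<le> f (\<xi> n i \<omega>)"
      unfolding \<xi>_def f_evec_scale[OF n] by (intro mult_left_mono) auto
    with less[OF that] show False by simp
  qed
  then have "first_argmax (\<lambda>i. f (evec (Xs i \<omega>))) n = k"
    by (intro first_argmax_unique k)
  then show ?thesis by (simp add: Z_def)
qed

text \<open>The events \<open>E k\<close> are disjoint, on \<open>E k\<close> the vector
  \<open>Z n\<close> is \<open>\<xi> n k\<close>, and each index contributes the same integral. Off
  their union, where the maximum is tied, only nonnegative values of h are dropped.\<close>

lemma nn_integral_Z_ge:
  fixes h :: "ereal ^ 'n \<Rightarrow> ennreal"
  assumes n: "n \<ge> 2" and h [measurable]: "h \<in> borel_measurable borel"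
  shows "of_nat n * (\<integral>\<^sup>+\<omega>. h (scaled n \<omega>) * ennreal (P.prob {\<omega>' \<in> space P. f (scaled n \<omega>') < f (scaled n \<omega>)} ^ (n - 1)) \<partial>P)
    \<le> (\<integral>\<^sup>+\<omega>. h (Z n \<omega>) \<partial>M)"
proof -
  define E where "E k = {\<omega>. \<forall>i\<in>{1..n} - {k}. f (\<xi> n i \<omega>) < f (\<xi> n k \<omega>)}" for k
  have m: "(\<lambda>\<omega>. h (\<xi> n k \<omega>) * indicator (E k) \<omega>) \<in> borel_measurable M" if "k \<in> {1..n}" for k
  proof -
    have "Measurable.pred M (\<lambda>\<omega>. \<forall>i\<in>{1..n} - {k}. f (\<xi> n i \<omega>) < f (\<xi> n k \<omega>))"
      using that by (intro pred_intros_finite borel_measurable_pred_less) auto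
    then have [measurable]: "(\<lambda>\<omega>. indicator (E k) \<omega> :: ennreal) \<in> borel_measurable M"
      unfolding E_def by (intro borel_measurable_indicator') (simp add: pred_def)
    have [measurable]: "\<xi> n k \<in> measurable M borel" using that by (intro \<xi>_measurable) auto
    show ?thesis by measurable
  qed
  have "(\<integral>\<^sup>+\<omega>. h (\<xi> n k \<omega>) * indicator (E k) \<omega> \<partial>M)
    = (\<integral>\<^sup>+\<omega>. h (scaled n \<omega>) * ennreal (P.prob {\<omega>' \<in> space P. f (scaled n \<omega>') < f (scaled n \<omega>)} ^ (n - 1)) \<partial>P)"
    if "k \<in> {1..n}" for k
    unfolding E_def \<xi>_def scaled_def
    using that n
    by (intro nn_integral_strict_argmax[where S = borel and X = X and Xs = Xs and g = "\<lambda>x. f (evec ((1 / a n) *\<^sub>R x))"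
          and h = "\<lambda>x. h (evec ((1 / a n) *\<^sub>R x))"] prob_M prob_P indep copies) measurable
  then have "of_nat n * (\<integral>\<^sup>+\<omega>. h (scaled n \<omega>) * ennreal (P.prob {\<omega>' \<in> space P. f (scaled n \<omega>') < f (scaled n \<omega>)} ^ (n - 1)) \<partial>P)
    = (\<Sum>k\<in>{1..n}. \<integral>\<^sup>+\<omega>. h (\<xi> n k \<omega>) * indicator (E k) \<omega> \<partial>M)"
    by simp
  also have "\<dots> = (\<integral>\<^sup>+\<omega>. (\<Sum>k\<in>{1..n}. h (\<xi> n k \<omega>) * indicator (E k) \<omega>) \<partial>M)"
    using m by (intro nn_integral_sum[symmetric])
  also have "\<dots> \<le> (\<integral>\<^sup>+\<omega>. h (Z n \<omega>) \<partial>M)"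
  proof (rule nn_integral_mono)
    fix \<omega>
    show "(\<Sum>k\<in>{1..n}. h (\<xi> n k \<omega>) * indicator (E k) \<omega>) \<le> h (Z n \<omega>)"
    proof (cases "\<exists>k\<in>{1..n}. \<omega> \<in> E k")
      case True
      then obtain k where k: "k \<in> {1..n}" "\<omega> \<in> E k" by auto
      have "j \<notin> {1..n} \<or> \<omega> \<notin> E j" if "j \<noteq> k" for j
      proof (rule ccontr)
        assume j: "\<not> (j \<notin> {1..n} \<or> \<omega> \<notin> E j)"
        have "f (\<xi> n k \<omega>) < f (\<xi> n j \<omega>)" using j k(1) that by (auto simp: E_def)
        moreover have "f (\<xi> n j \<omega>) < f (\<xi> n k \<omega>)" using j k(2) that by (auto simp: E_def)
        ultimately show False by simp
      qed
      then have "(\<Sum>k\<in>{1..n}. h (\<xi> n k \<omega>) * indicator (E k) \<omega>) = (\<Sum>j\<in>{1..n}. if j = k then h (\<xi> n k \<omega>) else 0)"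
        using k by (intro sum.cong) (auto simp: indicator_def)
      also have "\<dots> = h (\<xi> n k \<omega>)" using k by simp
      also have "\<dots> = h (Z n \<omega>)"
        using Z_strict_max[of n k \<omega>] k n by (auto simp: E_def)
      finally show ?thesis by simp
    qed (auto simp: indicator_def)
  qed
  finally show ?thesis .
qed

section \<open>Limits of integrals of continuous functions of \<open>Z n\<close>\<close>

lemma exp_V_integrable:
  fixes h :: "ereal ^ 'n \<Rightarrow> real"
  assumes h: "continuous_on UNIV h"
  shows "integrable N (\<lambda>x. h x * exp (- c * V x))"
proof -
  obtain B where B: "\<And>x. \<bar>h x\<bar> \<le> B" using continuous_bounded[OF h] by metis
  have [measurable]: "h \<in> borel_measurable borel" by (intro borel_measurable_continuous_onI h)
  have i: "integrable N (\<lambda>x. exp (- c * V x))"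
    by (rule integrableI_nonneg) (auto simp: nn_integral_exp_V[unfolded mult_minus_left])
  then have "integrable N (\<lambda>x. B * exp (- c * V x))" by simp
  then show ?thesis
  proof (rule Bochner_Integration.integrable_bound)
    show "AE x in N. norm (h x * exp (- c * V x)) \<le> norm (B * exp (- c * V x))"
      using B by (auto simp: abs_mult intro!: mult_right_mono order_trans[OF B abs_ge_self])
  qed measurable
qed

lemma integral_exp_V: "(\<integral>x. exp (- c * V x) \<partial>N) = 1"
  by (subst integral_eq_nn_integral) (auto simp: nn_integral_exp_V[unfolded mult_minus_left])

text \<open>Vague convergence is applied to two test functions: \<open>G j\<close> gives the main
  term, and \<open>H j\<close> prices the error \<epsilon> of the uniform lower bound. First j is
  fixed, then \<epsilon> in terms of the integral of \<open>H j\<close>, and only then does n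
  grow.\<close>

lemma Z_lower_bound:
  assumes h: "continuous_on UNIV h" "\<And>x. 0 \<le> h x" and e: "e > 0"
  shows "\<forall>\<^sub>F n in sequentially. (\<integral>x. h x * exp (- c * V x) \<partial>N) - e < (\<integral>\<omega>. h (Z n \<omega>) \<partial>M)"
proof -
  define L where "L = (\<integral>x. h x * exp (- c * V x) \<partial>N)"
  define O0 where "O0 = - D \<inter> - closure (Disc f)"
  \<comment> \<open>Points with \<open>f x = \<infinity>\<close> are removed: \<open>V\<close> has a
    default value there and the uniform lower bound does not cover them. They are
    \<open>N\<close>-null, as \<open>f\<close> is finite on \<open>range evec\<close>.\<close>
  define O' where "O' = {x \<in> O0. f x < \<infinity>}"
  have O0: "open O0" unfolding O0_def using D_closed by (intro open_Int) auto
  have f_cont: "continuous_on O0 f"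
    unfolding continuous_on_def O0_def Disc_def
    using closure_subset[of "Disc f"] by (force simp: Disc_def intro: tendsto_within_subset)
  have O': "open O'" "O' \<subseteq> - D"
  proof -
    have "O' = f -` {..<\<infinity>} \<inter> O0" by (auto simp: O'_def)
    then show "open O'" using f_cont O0 continuous_on_open_vimage[OF O0] by (metis open_lessThan)
  qed (auto simp: O'_def O0_def)
  have O_pos: "enn2real (f x) > 0" if "x \<in> O'" for x
    using that f_eq_0_iff[of x] by (auto simp: O'_def O0_def enn2real_positive_iff zero_less_iff_neq_zero)
  have V_cont: "continuous_on O' V"
  proof -
    have "continuous_on O' f" using f_cont by (rule continuous_on_subset) (auto simp: O'_def)
    then have "continuous_on O' (\<lambda>x. enn2real (f x))"
      unfolding continuous_on_def by (auto intro!: tendsto_enn2real simp: O'_def)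
    then show ?thesis
      unfolding V_def using O_pos by (intro continuous_on_powr' continuous_on_const) (auto intro: less_imp_le simp: less_le)
  qed
  have AE_O: "AE x in N. x \<in> O'"
  proof -
    have cl [measurable]: "closure (Disc f) \<in> sets borel" by simp
    have "emeasure N (closure (Disc f)) = 0"
      using Disc_null cl by (subst emeasure_N) (auto simp: Diff_eq)
    then have "AE x in N. x \<notin> closure (Disc f)"
      by (intro AE_not_in) (auto simp: null_sets_def)
    with AE_N_proper show ?thesis
      by eventually_elim (auto simp: O'_def O0_def f_evec[unfolded infinity_ennreal_def])
  qed
  obtain g :: "nat \<Rightarrow> ereal ^ 'n \<Rightarrow> real" and K where
    g: "\<And>j. test_fun (g j)" "\<And>j x. 0 \<le> g j x" "\<And>j x. g j x \<le> 1"
    "\<And>x. incseq (\<lambda>j. g j x)" "\<And>x. (\<lambda>j. g j x) \<longlonglongrightarrow> indicator O' x"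
    "\<And>j. closed (K j)" "\<And>j. K j \<subseteq> O'" "\<And>j x. x \<notin> K j \<Longrightarrow> g j x = 0"
    using open_test_cutoffs[OF O'] by metis
  define H where "H j x = h x * g j x" for j x
  define G where "G j x = h x * g j x * exp (- c * V x)" for j x
  have g_cont: "continuous_on UNIV (g j)" for j using g(1) by (simp add: test_fun_def)
  have H: "test_fun (H j)" for j
    using g(1)[of j] h(1) unfolding H_def test_fun_def by (auto intro!: continuous_intros)
  have G: "test_fun (G j)" for j
  proof -
    have "continuous_on O' (G j)"
      unfolding G_def by (intro continuous_intros V_cont continuous_on_subset[OF h(1)] continuous_on_subset[OF g_cont]) auto
    then have "continuous_on UNIV (G j)"
      by (rule continuous_on_UNIV_extend[OF _ O'(1) g(6)[of j] g(7)]) (simp add: G_def g(8))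
    then show ?thesis using g(1)[of j] unfolding test_fun_def by (auto simp: G_def)
  qed
  have HG0: "0 \<le> H j x" "0 \<le> G j x" for j x using h(2) g(2) by (auto simp: H_def G_def)
  note [measurable] = test_fun_measurable[OF H] test_fun_measurable[OF G]
  have h_meas [measurable]: "h \<in> borel_measurable borel" by (intro borel_measurable_continuous_onI h)
  have "(\<lambda>j. \<integral>x. G j x \<partial>N) \<longlonglongrightarrow> L"
    unfolding L_def
  proof (rule integral_dominated_convergence)
    show "AE x in N. (\<lambda>j. G j x) \<longlonglongrightarrow> h x * exp (- c * V x)"
      using AE_O
    proof eventually_elim
      case (elim x)
      have "(\<lambda>j. G j x) \<longlonglongrightarrow> h x * indicator O' x * exp (- c * V x)"
        unfolding G_def by (intro tendsto_intros g)
      with elim show ?case by simp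
    qed
    show "AE x in N. norm (G j x) \<le> h x * exp (- c * V x)" for j
      using h(2) g(2,3) by (auto simp: G_def abs_mult mult_left_le intro!: mult_right_mono)
    show "integrable N (\<lambda>x. h x * exp (- c * V x))" by (rule exp_V_integrable[OF h(1)])
  qed measurable
  then have "\<forall>\<^sub>F j in sequentially. L - e / 4 < (\<integral>x. G j x \<partial>N)"
    using e by (intro order_tendstoD(1)) auto
  then obtain j where j: "L - e / 4 < (\<integral>x. G j x \<partial>N)"
    by (auto simp: eventually_sequentially)
  define I where "I = (\<integral>x. H j x \<partial>N)"
  have I: "I \<ge> 0" unfolding I_def by (intro Bochner_Integration.integral_nonneg HG0)
  \<comment> \<open>n times the integral of \<open>H j\<close> is eventually below
    \<open>I + 1\<close>, so this error stays within e / 4; another e / 4 was spent on choosing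
    j.\<close>
  define \<epsilon> where "\<epsilon> = e / (4 * (I + 1))"
  have \<epsilon>: "\<epsilon> > 0" "\<epsilon> * (I + 1) = e / 4" using e I by (auto simp: \<epsilon>_def field_simps)
  have ev1: "\<forall>\<^sub>F n in sequentially. L - e / 4 < real n * (\<integral>\<omega>. G j (scaled n \<omega>) \<partial>P)"
    by (rule order_tendstoD(1)[OF vague[OF G] j])
  have ev2: "\<forall>\<^sub>F n in sequentially. real n * (\<integral>\<omega>. H j (scaled n \<omega>) \<partial>P) < I + 1"
    by (rule order_tendstoD(2)[OF vague[OF H]]) (simp add: I_def)
  from ev1 ev2 uniform_lower_bound[OF \<epsilon>(1)] eventually_ge_at_top[of 2]
  have "\<forall>\<^sub>F n in sequentially. L - e < (\<integral>\<omega>. h (Z n \<omega>) \<partial>M)"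
  proof eventually_elim
    case (elim n)
    define p where "p \<omega> = P.prob {\<omega>' \<in> space P. f (scaled n \<omega>') < f (scaled n \<omega>)} ^ (n - 1)" for \<omega>
    have int: "integrable P (\<lambda>\<omega>. G j (scaled n \<omega>))" "integrable P (\<lambda>\<omega>. H j (scaled n \<omega>))"
      using H[of j] G[of j] by (auto intro!: continuous_P_integrable simp: test_fun_def)
    have pt: "G j (scaled n \<omega>) - \<epsilon> * H j (scaled n \<omega>) \<le> h (scaled n \<omega>) * p \<omega>" for \<omega>
    proof (cases "g j (scaled n \<omega>) = 0")
      case True
      then show ?thesis using h(2) by (simp add: G_def H_def p_def)
    next
      case False
      then have "scaled n \<omega> \<in> O'" using g(7,8) by blast
      then have "exp (- c * V (scaled n \<omega>)) - \<epsilon> \<le> P.prob {\<omega>' \<in> space P. f (scaled n \<omega>') < f (scaled n \<omega>)} ^ n"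
        using elim(3) by (auto simp: O'_def O0_def)
      \<comment> \<open>The bound is for the power n while there are n - 1 competitors; lowering the
        exponent can only increase a power of a probability.\<close>
      also have "\<dots> \<le> p \<omega>" unfolding p_def by (intro power_decreasing) auto
      finally have *: "exp (- c * V (scaled n \<omega>)) - \<epsilon> \<le> p \<omega>" .
      have "G j (scaled n \<omega>) - \<epsilon> * H j (scaled n \<omega>) = H j (scaled n \<omega>) * (exp (- c * V (scaled n \<omega>)) - \<epsilon>)"
        by (simp add: G_def H_def algebra_simps)
      also have "\<dots> \<le> H j (scaled n \<omega>) * p \<omega>"
        using * HG0 by (intro mult_left_mono) auto
      also have "\<dots> \<le> h (scaled n \<omega>) * p \<omega>"
        using g(3) h(2) by (intro mult_right_mono) (auto simp: H_def p_def mult_left_le)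
      finally show ?thesis .
    qed
    have hZ: "integrable M (\<lambda>\<omega>. h (Z n \<omega>))"
    proof -
      obtain B where "\<And>x. \<bar>h x\<bar> \<le> B" using continuous_bounded[OF h(1)] by metis
      then show ?thesis using elim by (intro M.integrable_const_bound[of _ B]) auto
    qed
    have "ennreal (real n * (\<integral>\<omega>. G j (scaled n \<omega>) - \<epsilon> * H j (scaled n \<omega>) \<partial>P))
      = of_nat n * ennreal (\<integral>\<omega>. G j (scaled n \<omega>) - \<epsilon> * H j (scaled n \<omega>) \<partial>P)"
      by (simp add: ennreal_mult' ennreal_of_nat_eq_real_of_nat)
    also have "\<dots> \<le> of_nat n * (\<integral>\<^sup>+\<omega>. ennreal (G j (scaled n \<omega>) - \<epsilon> * H j (scaled n \<omega>)) \<partial>P)"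
    proof (rule mult_left_mono)
      \<comment> \<open>\<open>?u\<close> may be negative, and \<open>ennreal\<close> sends negative
        values to 0; the positive part has at least the same integral.\<close>
      let ?u = "\<lambda>\<omega>. G j (scaled n \<omega>) - \<epsilon> * H j (scaled n \<omega>)"
      have iu: "integrable P ?u" using int by auto
      then have "ennreal (\<integral>\<omega>. ?u \<omega> \<partial>P) \<le> ennreal (\<integral>\<omega>. max 0 (?u \<omega>) \<partial>P)"
        by (intro ennreal_leI integral_mono) auto
      also have "\<dots> = (\<integral>\<^sup>+\<omega>. ennreal (max 0 (?u \<omega>)) \<partial>P)"
        using iu by (intro nn_integral_eq_integral[symmetric]) auto
      finally show "ennreal (\<integral>\<omega>. ?u \<omega> \<partial>P) \<le> (\<integral>\<^sup>+\<omega>. ennreal (?u \<omega>) \<partial>P)"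
        by simp
    qed simp
    also have "\<dots> \<le> of_nat n * (\<integral>\<^sup>+\<omega>. ennreal (h (scaled n \<omega>)) * ennreal (p \<omega>) \<partial>P)"
      using pt h(2) by (intro mult_left_mono nn_integral_mono) (auto simp: ennreal_mult'[symmetric] intro!: ennreal_leI)
    also have "\<dots> \<le> (\<integral>\<^sup>+\<omega>. ennreal (h (Z n \<omega>)) \<partial>M)"
      unfolding p_def using elim by (intro nn_integral_Z_ge) auto
    also have "\<dots> = ennreal (\<integral>\<omega>. h (Z n \<omega>) \<partial>M)"
      using h(2) hZ by (intro nn_integral_eq_integral) auto
    finally have "real n * (\<integral>\<omega>. G j (scaled n \<omega>) - \<epsilon> * H j (scaled n \<omega>) \<partial>P) \<le> (\<integral>\<omega>. h (Z n \<omega>) \<partial>M)"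
      using h(2) by (subst (asm) ennreal_le_iff) (auto intro!: Bochner_Integration.integral_nonneg)
    moreover have "real n * (\<integral>\<omega>. G j (scaled n \<omega>) - \<epsilon> * H j (scaled n \<omega>) \<partial>P)
      = real n * (\<integral>\<omega>. G j (scaled n \<omega>) \<partial>P) - \<epsilon> * (real n * (\<integral>\<omega>. H j (scaled n \<omega>) \<partial>P))"
      using int by (simp add: algebra_simps)
    moreover have "\<epsilon> * (real n * (\<integral>\<omega>. H j (scaled n \<omega>) \<partial>P)) \<le> \<epsilon> * (I + 1)"
      using elim(2) \<epsilon> by (intro mult_left_mono) auto
    ultimately show ?case using elim(1) \<epsilon>(2) e by linarith
  qed
  then show ?thesis by (simp add: L_def)
qed

lemma Z_converges:
  assumes h: "continuous_on UNIV h"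
  shows "(\<lambda>n. \<integral>\<omega>. h (Z n \<omega>) \<partial>M) \<longlonglongrightarrow> (\<integral>x. h x * exp (- c * V x) \<partial>N)"
proof -
  obtain B where B: "\<And>x. \<bar>h x\<bar> \<le> B" using continuous_bounded[OF h] by metis
  have B': "0 \<le> B + h x" "0 \<le> B - h x" for x using B[of x] by linarith+
  have [measurable]: "h \<in> borel_measurable borel" by (intro borel_measurable_continuous_onI h)
  have hZ: "integrable M (\<lambda>\<omega>. h (Z n \<omega>))" if "n \<ge> 1" for n
    using B that by (intro M.integrable_const_bound[of _ B]) auto
  have iN: "integrable N (\<lambda>x. h x * exp (- c * V x))" by (rule exp_V_integrable[OF h])
  have iE: "integrable N (\<lambda>x. exp (- c * V x))" using exp_V_integrable[of "\<lambda>_. 1"] by simp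
  show ?thesis
  proof (rule order_tendstoI)
    fix y assume y: "y < (\<integral>x. h x * exp (- c * V x) \<partial>N)"
    have "\<forall>\<^sub>F n in sequentially. (\<integral>x. (B + h x) * exp (- c * V x) \<partial>N) - ((\<integral>x. h x * exp (- c * V x) \<partial>N) - y) < (\<integral>\<omega>. B + h (Z n \<omega>) \<partial>M)"
      using y by (intro Z_lower_bound continuous_intros h B') auto
    then show "\<forall>\<^sub>F n in sequentially. y < (\<integral>\<omega>. h (Z n \<omega>) \<partial>M)"
      using eventually_ge_at_top[of 1]
    proof eventually_elim
      case (elim n)
      \<comment> \<open>By the mass 1 of the limit law, the constant B contributes B to both sides
        and cancels.\<close>
      have "(\<integral>x. (B + h x) * exp (- c * V x) \<partial>N) = B + (\<integral>x. h x * exp (- c * V x) \<partial>N)"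
        unfolding distrib_right using iN iE integral_exp_V by (subst Bochner_Integration.integral_add) auto
      moreover have "(\<integral>\<omega>. B + h (Z n \<omega>) \<partial>M) = B + (\<integral>\<omega>. h (Z n \<omega>) \<partial>M)"
        using hZ[OF elim(2)] by (simp add: M.prob_space)
      ultimately show ?case using elim by linarith
    qed
  next
    fix y assume y: "(\<integral>x. h x * exp (- c * V x) \<partial>N) < y"
    have "\<forall>\<^sub>F n in sequentially. (\<integral>x. (B - h x) * exp (- c * V x) \<partial>N) - (y - (\<integral>x. h x * exp (- c * V x) \<partial>N)) < (\<integral>\<omega>. B - h (Z n \<omega>) \<partial>M)"
      using y by (intro Z_lower_bound continuous_intros h B') auto
    then show "\<forall>\<^sub>F n in sequentially. (\<integral>\<omega>. h (Z n \<omega>) \<partial>M) < y"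
      using eventually_ge_at_top[of 1]
    proof eventually_elim
      case (elim n)
      have "(\<integral>x. (B - h x) * exp (- c * V x) \<partial>N) = B - (\<integral>x. h x * exp (- c * V x) \<partial>N)"
        unfolding left_diff_distrib using iN iE integral_exp_V by (subst Bochner_Integration.integral_diff) auto
      moreover have "(\<integral>\<omega>. B - h (Z n \<omega>) \<partial>M) = B - (\<integral>\<omega>. h (Z n \<omega>) \<partial>M)"
        using hZ[OF elim(2)] by (simp add: M.prob_space)
      ultimately show ?case using elim by linarith
    qed
  qed
qed

text \<open>Both claims depend only on the law of \<open>Y\<close>. Integrals pass from
  \<open>Q\<close> to the density over \<nu> and from \<nu> to \<open>N\<close>; properness holds
  \<nu>-almost everywhere, and a measure with a density inherits it.\<close>

lemma limit_law_distr:
  fixes Q :: "'q measure"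
  assumes Q: "prob_space Q" and Y [measurable]: "Y \<in> measurable Q (restrict_space borel (- D))"
    and law: "distr Q (restrict_space borel (- D)) Y = limit_law \<alpha> f \<nu>"
  shows "conv_in_distr M Z Q Y" "AE \<omega> in Q. Y \<omega> \<in> range evec - D"
proof -
  have m: "(\<lambda>x. ennreal (exp (- c * V x))) \<in> borel_measurable \<nu>"
    by (rule measurable_nuI) measurable
  show "conv_in_distr M Z Q Y"
    unfolding conv_in_distr_def
  proof (intro allI impI)
    fix h :: "ereal ^ 'n \<Rightarrow> real" assume h: "continuous_on UNIV h \<and> bounded (range h)"
    then have hm: "h \<in> borel_measurable borel" by (intro borel_measurable_continuous_onI) auto
    have "(\<integral>\<omega>. h (Y \<omega>) \<partial>Q) = (\<integral>x. h x \<partial>(limit_law \<alpha> f \<nu>))"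
      unfolding law[symmetric]
      by (intro integral_distr[symmetric] Y measurable_restrict_space1 hm)
    also have "\<dots> = (\<integral>x. exp (- c * V x) * h x \<partial>\<nu>)"
      unfolding limit_law_eq
      by (intro integral_real_density measurable_nuI hm) (auto intro!: measurable_nuI)
    also have "\<dots> = (\<integral>x. h x * exp (- c * V x) \<partial>N)"
      using hm by (subst integral_N) (auto simp: mult.commute)
    finally show "(\<lambda>n. \<integral>\<omega>. h (Z n \<omega>) \<partial>M) \<longlonglongrightarrow> (\<integral>\<omega>. h (Y \<omega>) \<partial>Q)"
      using Z_converges h by simp
  qed
  have "AE x in \<nu>. x \<in> range evec - D"
    using AE_N_proper unfolding N_def by (subst (asm) AE_distr_iff[OF id_measurable_nu]) auto
  then have "AE x in distr Q (restrict_space borel (- D)) Y. x \<in> range evec - D"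
    unfolding law limit_law_eq by (subst AE_density[OF m]) auto
  then show "AE \<omega> in Q. Y \<omega> \<in> range evec - D"
    by (rule AE_distrD[OF Y])
qed

end

text \<open>\<open>Y\<close> is any random vector in \<open>- D\<close> with the limit law. As this
  law is a probability measure, such a vector exists on a suitable space.\<close>

theorem theorem3p14:
  fixes D :: "(ereal ^ 'n) set"
    and \<alpha> :: real
    and a :: "nat \<Rightarrow> real"
    and \<nu> :: "(ereal ^ 'n) measure"
    and P :: "'a measure" and X :: "'a \<Rightarrow> real ^ 'n"
    and \<tau> :: "ereal ^ 'n \<Rightarrow> ennreal"
    and \<sigma> :: "(ereal ^ 'n) measure"
    and f :: "ereal ^ 'n \<Rightarrow> ennreal"
    and M :: "'b measure" and Xs :: "nat \<Rightarrow> 'b \<Rightarrow> real ^ 'n"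
    and k :: "nat \<Rightarrow> 'b \<Rightarrow> nat"
  assumes D: "closed D" "pos_cone D"
    and alpha: "\<alpha> > 0"
    and P: "prob_space P"
    and RV: "RV P X \<alpha> a D \<nu>"
    and nu_supp: "emeasure \<nu> (UNIV - (range evec \<union> D)) = 0"
    and polar: "polar_radius D \<tau>"
    and sigma: "\<sigma> = spectral_measure D \<tau> \<nu>"
    and f_borel: "f \<in> borel_measurable borel"
    and H: "\<forall>x. f (evec x) < \<infinity>"
      "f 0 = 0"
      "\<forall>c>0. \<forall>x. x \<noteq> 0 \<longrightarrow> f (escale c x) = ennreal c * f x"
    and F: "\<forall>\<epsilon>::real. \<epsilon> > 0 \<longrightarrow> bounded_away D {x. f x > ennreal \<epsilon>}"
      "\<forall>K. compact K \<and> K \<subseteq> - D \<longrightarrow> (INF x\<in>K. f x) > 0"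
    and C: "emeasure \<nu> (closure (Disc f) \<inter> - D) = 0"
    and M: "prob_space M"
    and indep: "prob_space.indep_vars M (\<lambda>_. borel) Xs {1..}"
    and copies: "\<forall>i\<ge>1. distr M borel (Xs i) = distr P borel X"
    and k: "\<forall>n \<omega>. k n \<omega> = first_argmax (\<lambda>i. f (evec (Xs i \<omega>))) n"
  shows "tail_const f \<nu> = (\<integral>\<^sup>+ \<theta>. ennreal (enn2real (f \<theta>) powr \<alpha>) \<partial>\<sigma>)
    \<and> tail_const f \<nu> < \<infinity>
    \<and> prob_space (limit_law \<alpha> f \<nu>)
    \<and> (\<forall>(Q :: 'c measure) Y.
          prob_space Q \<and> Y \<in> measurable Q (restrict_space borel (- D))
          \<and> distr Q (restrict_space borel (- D)) Y = limit_law \<alpha> f \<nu>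
          \<longrightarrow> conv_in_distr M (\<lambda>n \<omega>. evec ((1 / a n) *\<^sub>R Xs (k n \<omega>) \<omega>)) Q Y
            \<and> (AE \<omega> in Q. Y \<omega> \<in> range evec - D))"
proof -
  have rv: "regular_variation D \<nu> P X \<alpha> a \<tau>"
    by (intro regular_variation.intro D(1) P RV polar)
  have hf: "homogeneous_functional D \<nu> P X \<alpha> a \<tau> f"
  proof (rule homogeneous_functional.intro[OF rv], unfold_locales)
    show "f (evec y) < \<infinity>" for y by (rule H(1)[rule_format])
    show "f (escale c x) = ennreal c * f x" if "c > 0" "x \<noteq> 0" for c x
      using H(3)[rule_format, OF that] .
    show "bounded_away D {x. ennreal \<epsilon> < f x}" if "\<epsilon> > 0" for \<epsilon>
      using F(1)[rule_format, OF that] .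
    show "(INF x\<in>K. f x) > 0" if "compact K" "K \<subseteq> - D" for K
      using F(2)[rule_format, OF conjI[OF that]] .
  qed (rule f_borel H(2) C)+
  interpret iid_sample D \<nu> P X \<alpha> a \<tau> f M Xs
    by (rule iid_sample.intro[OF hf], rule iid_sample_axioms.intro)
      (rule M indep copies[rule_format], assumption?)+
  have Z: "(\<lambda>n \<omega>. evec ((1 / a n) *\<^sub>R Xs (k n \<omega>) \<omega>)) = Z"
    using k by (simp add: fun_eq_iff Z_def \<xi>_def)
  show ?thesis
    unfolding Z sigma
    by (intro conjI allI impI tail_const_spectral tail_const_finite prob_space_limit_law limit_law_distr) blast+
qed

end
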